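(* Let $G$ be a graph containing a spanning triangle-tree. Then $G$ has no nowhere-zero $3$-flow if and only if either $G$ is $K_4$, or $G$ is a bull-growing of some graph $G_1$ such that $G_1$ contains a spanning triangle-tree and $G_1$ has no nowhere-zero $3$-flow. In other words, $G$ has no nowhere-zero $3$-flow if and only if $G$ is formed from $K_4$ by a (possibly empty) series of bull-growing operations.
   Context: Graphs are finite, may contain parallel edges, but have no loops. Nowhere-zero $3$-flow: a pair $(D,f)$ where $D$ is an orientation of $G$ and $f:E(G)\to\{\pm1,\pm2\}$ satisfies $\sum_{e\in E_D^+(v)}f(e)=\sum_{e\in E_D^-(v)}f(e)$ for every vertex $v$, where $E_D^+(v)$, $E_D^-(v)$ are the sets of arcs leaving and entering $v$. Triangle-tree: a graph formed by starting with a triangle $x_1x_2x_3$ and then repeatedly (zero or more times) adding a new vertex $x_{j+1}$ joined to exactly two vertices $y,z$ that are adjacent in the graph already constructed (so $x_{j+1},y,z$ form a triangle). A spanning triangle-tree of $G$ is a subgraph of $G$ that is a triangle-tree and contains all vertices of $G$. Bull-reduction / bull-growing: let $u,v$ be two adjacent vertices of degree $3$ in a graph $G$ with a common neighbor $w$; let $a$ be the third neighbor of $u$ (other than $v,w$) and $b$ the third neighbor of $v$ (other than $u,w$); $a=b$ is allowed. Let $H=G-u-v+ab$, i.e. delete $u,v$ and add a new edge $ab$ (possibly parallel to existing edges), where if $a=b$ the resulting loop is deleted (so $H=G-u-v$). Then $H$ is called a bull-reduction of $G$, and $G$ is called a bull-growing of $H$. *)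

theory Defs
  imports "Graph_Theory.Digraph"
begin

text \<open>
  Undirected multigraphs are given by incidence. Edges have an identity of their own, so that
  parallel edges can be oriented, and can carry flow values, independently of each other. The
  value of the field \<open>ends\<close> on non-edges is irrelevant.
\<close>

record ('v, 'e) mgraph =
  vertices :: "'v set"
  edges :: "'e set"
  ends :: "'e \<Rightarrow> 'v set"

locale multigraph =
  fixes G :: "('v, 'e) mgraph"
  assumes finite_vertices: "finite (vertices G)"
    and finite_edges: "finite (edges G)"
    and ends_subset: "e \<in> edges G \<Longrightarrow> ends G e \<subseteq> vertices G"
    and no_loops: "e \<in> edges G \<Longrightarrow> card (ends G e) = 2"

definition adjacent :: "('v, 'e) mgraph \<Rightarrow> 'v \<Rightarrow> 'v \<Rightarrow> bool" where
  "adjacent G x y \<longleftrightarrow> (\<exists>e \<in> edges G. ends G e = {x, y})"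

definition neighbors :: "('v, 'e) mgraph \<Rightarrow> 'v \<Rightarrow> 'v set" where
  "neighbors G x = {y. adjacent G x y}"

definition degree :: "('v, 'e) mgraph \<Rightarrow> 'v \<Rightarrow> nat" where
  "degree G x = card {e \<in> edges G. x \<in> ends G e}"

definition is_K4 :: "('v, 'e) mgraph \<Rightarrow> bool" where
  "is_K4 G \<longleftrightarrow> multigraph G \<and> card (vertices G) = 4 \<and>
     (\<forall>x \<in> vertices G. \<forall>y \<in> vertices G. x \<noteq> y \<longrightarrow> (\<exists>!e. e \<in> edges G \<and> ends G e = {x, y}))"


definition orientation :: "('v, 'e) mgraph \<Rightarrow> ('v, 'e) pre_digraph \<Rightarrow> bool" where
  "orientation G D \<longleftrightarrow> verts D = vertices G \<and> arcs D = edges G \<and>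
     (\<forall>e \<in> edges G. {tail D e, head D e} = ends G e)"

definition nowhere_zero_3_flow ::
    "('v, 'e) mgraph \<Rightarrow> ('v, 'e) pre_digraph \<Rightarrow> ('e \<Rightarrow> int) \<Rightarrow> bool" where
  "nowhere_zero_3_flow G D f \<longleftrightarrow> orientation G D \<and>
     (\<forall>e \<in> edges G. f e \<in> {1, -1, 2, -2}) \<and>
     (\<forall>v \<in> vertices G. (\<Sum>e \<in> out_arcs D v. f e) = (\<Sum>e \<in> in_arcs D v. f e))"

definition has_nowhere_zero_3_flow :: "('v, 'e) mgraph \<Rightarrow> bool" where
  "has_nowhere_zero_3_flow G \<longleftrightarrow> (\<exists>D f. nowhere_zero_3_flow G D f)"


inductive triangle_tree :: "('v, 'e) mgraph \<Rightarrow> bool" where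
  triangle:
    "\<lbrakk> distinct [x1, x2, x3]; distinct [e1, e2, e3];
       vertices T = {x1, x2, x3}; edges T = {e1, e2, e3};
       ends T e1 = {x1, x2}; ends T e2 = {x2, x3}; ends T e3 = {x3, x1} \<rbrakk>
     \<Longrightarrow> triangle_tree T"
| add_vertex:
    "\<lbrakk> triangle_tree T; adjacent T y z; x \<notin> vertices T;
       e1 \<notin> edges T; e2 \<notin> edges T; e1 \<noteq> e2 \<rbrakk>
     \<Longrightarrow> triangle_tree (T\<lparr> vertices := insert x (vertices T),
                           edges := insert e1 (insert e2 (edges T)),
                           ends := (ends T)(e1 := {x, y}, e2 := {x, z}) \<rparr>)"

definition is_subgraph :: "('v, 'e) mgraph \<Rightarrow> ('v, 'e) mgraph \<Rightarrow> bool" where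
  "is_subgraph H G \<longleftrightarrow> vertices H \<subseteq> vertices G \<and> edges H \<subseteq> edges G \<and>
     (\<forall>e \<in> edges H. ends H e = ends G e)"

definition spanning_triangle_tree :: "('v, 'e) mgraph \<Rightarrow> ('v, 'e) mgraph \<Rightarrow> bool" where
  "spanning_triangle_tree T G \<longleftrightarrow>
     triangle_tree T \<and> is_subgraph T G \<and> vertices T = vertices G"

definition has_spanning_triangle_tree :: "('v, 'e) mgraph \<Rightarrow> bool" where
  "has_spanning_triangle_tree G \<longleftrightarrow> (\<exists>T. spanning_triangle_tree T G)"


definition delete_vertices :: "('v, 'e) mgraph \<Rightarrow> 'v set \<Rightarrow> ('v, 'e) mgraph" where
  "delete_vertices G S =
     G\<lparr> vertices := vertices G - S, edges := {e \<in> edges G. ends G e \<inter> S = {}} \<rparr>"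

definition add_edge :: "('v, 'e) mgraph \<Rightarrow> 'e \<Rightarrow> 'v \<Rightarrow> 'v \<Rightarrow> ('v, 'e) mgraph" where
  "add_edge G e a b = G\<lparr> edges := insert e (edges G), ends := (ends G)(e := {a, b}) \<rparr>"

text \<open>
  \<open>bull_reduction G H\<close>: \<open>H\<close> is a bull-reduction of \<open>G\<close>. The name \<open>e\<close> of the new edge is
  arbitrary, as long as it does not name an edge of \<open>G - u - v\<close>. It may be the name of one of the
  five deleted edges, so a name is always available in the type of the edges of \<open>G\<close>.
\<close>

definition bull_reduction :: "('v, 'e) mgraph \<Rightarrow> ('v, 'e) mgraph \<Rightarrow> bool" where
  "bull_reduction G H \<longleftrightarrow> multigraph G \<and>
     (\<exists>u \<in> vertices G. \<exists>v \<in> vertices G. \<exists>w a b.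
        adjacent G u v \<and> degree G u = 3 \<and> degree G v = 3 \<and>
        neighbors G u = {v, w, a} \<and> a \<noteq> v \<and> a \<noteq> w \<and>
        neighbors G v = {u, w, b} \<and> b \<noteq> u \<and> b \<noteq> w \<and>
        (if a = b then H = delete_vertices G {u, v}
         else (\<exists>e. e \<notin> edges (delete_vertices G {u, v}) \<and>
                   H = add_edge (delete_vertices G {u, v}) e a b)))"

abbreviation bull_growing :: "('v, 'e) mgraph \<Rightarrow> ('v, 'e) mgraph \<Rightarrow> bool" where
  "bull_growing G H \<equiv> bull_reduction G H"

text \<open>
  \<open>bull_growing G H\<close>: \<open>G\<close> is a bull-growing of \<open>H\<close>.
\<close>

inductive formed_from_K4 :: "('v, 'e) mgraph \<Rightarrow> bool" where
  K4: "is_K4 G \<Longrightarrow> formed_from_K4 G"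
| grow: "\<lbrakk> formed_from_K4 H; bull_growing G H \<rbrakk> \<Longrightarrow> formed_from_K4 G"

end

theory Submission
  imports Defs
begin

text \<open>
  By Tutte's rerouting argument, a nowhere-zero 3-flow is the same as an orientation in which the
  out-degree minus in-degree of every vertex is 0 modulo 3. Let \<open>T\<close> be the spanning triangle-tree,
  \<open>X\<close> the set of other edges, and \<open>\<kappa>\<close> the proper colouring of \<open>T\<close> by residues modulo 3. A boundary
  \<open>\<beta>\<close> of total 0 is realised by an orientation of \<open>T\<close> as soon as \<open>\<Sum>u. \<kappa> u * \<beta> u\<close> is nonzero modulo 3,
  or \<open>\<beta> x\<close> vanishes at some vertex \<open>x\<close> of degree 2 in \<open>T\<close>. Orienting the edges of \<open>X\<close> in both ways
  then shows for a graph without a flow that \<open>X\<close> joins only vertices of equal colour, that every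
  leaf of \<open>T\<close> meets exactly one edge of \<open>X\<close>, and, for a vertex \<open>v\<close> that becomes a leaf after the
  deletion of a set \<open>L\<close> of adjacent leaves, that reversing exactly one edge of \<open>X\<close> changes
  \<open>\<beta> v - sum \<beta> L\<close> modulo 3. Hence either two leaves in \<open>L\<close> are joined by an edge of \<open>X\<close>, or \<open>L\<close> is a single leaf \<open>x\<close> and
  \<open>v\<close> meets no edge of \<open>X\<close>. In both cases there is a bull whose removal leaves a triangle-tree,
  unless the graph is \<open>K\<^sub>4\<close>.
\<close>

section \<open>Orientations with prescribed boundary modulo 3\<close>

text \<open>The boundary of a single arc, one unit sent from \<open>a\<close> to \<open>b\<close>.
  It vanishes for \<open>a = b\<close>, which later matches the deleted loop of a
  bull-reduction.\<close>

definition arc :: "'v \<Rightarrow> 'v \<Rightarrow> 'v \<Rightarrow> int" where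
  "arc a b u = of_bool (u = a) - of_bool (u = b)"

text \<open>The boundary is compared at all elements of the vertex type, so a realisable
  \<open>\<beta>\<close> vanishes modulo 3 at every element that is not an end of an edge in
  \<open>E\<close>.\<close>

definition orientable :: "('e \<Rightarrow> 'v set) \<Rightarrow> 'e set \<Rightarrow> ('v \<Rightarrow> int) \<Rightarrow> bool" where
  "orientable en E \<beta> \<longleftrightarrow> (\<exists>t h. (\<forall>e\<in>E. en e = {t e, h e}) \<and>
     (\<forall>u. 3 dvd \<beta> u - (\<Sum>e\<in>E. arc (t e) (h e) u)))"

lemma orientable_empty: "orientable en {} \<beta> \<longleftrightarrow> (\<forall>u. 3 dvd \<beta> u)"
  by (simp add: orientable_def)

lemma orientable_cong:
  assumes "orientable en E \<beta>" and "\<And>u. 3 dvd \<beta> u - \<gamma> u"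
  shows "orientable en E \<gamma>"
proof -
  from assms(1) obtain t h where th: "\<forall>e\<in>E. en e = {t e, h e}"
    "\<And>u. 3 dvd \<beta> u - (\<Sum>e\<in>E. arc (t e) (h e) u)"
    unfolding orientable_def by blast
  have "3 dvd \<gamma> u - (\<Sum>e\<in>E. arc (t e) (h e) u)" for u
    using th(2)[of u] assms(2)[of u] by presburger
  with th(1) show ?thesis
    unfolding orientable_def by blast
qed

lemma orientable_ends_cong:
  assumes "\<And>e. e \<in> E \<Longrightarrow> en e = en' e"
  shows "orientable en E \<beta> \<longleftrightarrow> orientable en' E \<beta>"
  using assms by (auto simp: orientable_def)

text \<open>The sign \<open>s\<close> records the direction of the new edge, whose contribution is
  moved into the prescribed boundary. This recursion drives the edge-by-edge arguments
  below.\<close>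

lemma orientable_insert:
  assumes "finite E" "e \<notin> E" "en e = {a, b}"
  shows "orientable en (insert e E) \<beta> \<longleftrightarrow>
    (\<exists>s\<in>{1, -1}. orientable en E (\<lambda>u. \<beta> u - s * arc a b u))"
proof
  assume "orientable en (insert e E) \<beta>"
  then obtain t h where th: "\<forall>e\<in>insert e E. en e = {t e, h e}"
    "\<And>u. 3 dvd \<beta> u - (\<Sum>e\<in>insert e E. arc (t e) (h e) u)"
    unfolding orientable_def by blast
  have ab: "t e = a \<and> h e = b \<or> t e = b \<and> h e = a"
    using th(1) assms(3) by (auto simp: doubleton_eq_iff)
  define s :: int where "s = (if t e = a \<and> h e = b then 1 else -1)"
  have s: "arc (t e) (h e) u = s * arc a b u" for u
    using ab by (auto simp: s_def arc_def)
  have "3 dvd \<beta> u - s * arc a b u - (\<Sum>e\<in>E. arc (t e) (h e) u)" for u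
    using th(2)[of u] assms by (simp add: s algebra_simps)
  then have "orientable en E (\<lambda>u. \<beta> u - s * arc a b u)"
    using th(1) unfolding orientable_def by blast
  then show "\<exists>s\<in>{1, -1}. orientable en E (\<lambda>u. \<beta> u - s * arc a b u)"
    by (auto simp: s_def split: if_splits)
next
  assume "\<exists>s\<in>{1, -1}. orientable en E (\<lambda>u. \<beta> u - s * arc a b u)"
  then obtain s :: int and t h where s: "s = 1 \<or> s = -1"
    and th: "\<forall>e\<in>E. en e = {t e, h e}"
      "\<And>u. 3 dvd \<beta> u - s * arc a b u - (\<Sum>e\<in>E. arc (t e) (h e) u)"
    unfolding orientable_def by blast
  define t' where "t' = t(e := if s = 1 then a else b)"
  define h' where "h' = h(e := if s = 1 then b else a)"
  have arc: "arc (t' e) (h' e) u = s * arc a b u" for u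
    using s by (auto simp: t'_def h'_def arc_def)
  have rest: "(\<Sum>e\<in>E. arc (t' e) (h' e) u) = (\<Sum>e\<in>E. arc (t e) (h e) u)" for u
    by (rule sum.cong) (use assms in \<open>auto simp: t'_def h'_def\<close>)
  have "\<forall>e\<in>insert e E. en e = {t' e, h' e}"
    using th(1) assms by (auto simp: t'_def h'_def)
  moreover have "3 dvd \<beta> u - (\<Sum>e\<in>insert e E. arc (t' e) (h' e) u)" for u
    using th(2)[of u] assms by (simp add: arc rest algebra_simps)
  ultimately show "orientable en (insert e E) \<beta>"
    unfolding orientable_def by blast
qed

lemma orientable_insertI:
  assumes "orientable en E (\<lambda>u. \<beta> u - s * arc a b u)" "s = 1 \<or> s = -1"
    "finite E" "e \<notin> E" "en e = {a, b}"
  shows "orientable en (insert e E) \<beta>"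
  using assms(1,2) by (subst orientable_insert) (use assms(3-5) in auto)

lemma orientable_zero_off_support:
  assumes "orientable en E \<beta>" "\<And>e. e \<in> E \<Longrightarrow> u \<notin> en e"
  shows "3 dvd \<beta> u"
proof -
  from assms(1) obtain t h where th: "\<forall>e\<in>E. en e = {t e, h e}"
    "\<And>u. 3 dvd \<beta> u - (\<Sum>e\<in>E. arc (t e) (h e) u)"
    unfolding orientable_def by blast
  have "(\<Sum>e\<in>E. arc (t e) (h e) u) = 0"
  proof (rule sum.neutral, intro ballI)
    fix e assume "e \<in> E"
    then have "u \<notin> {t e, h e}"
      using assms(2) th(1) by metis
    then show "arc (t e) (h e) u = 0"
      by (auto simp: arc_def)
  qed
  with th(2)[of u] show ?thesis by simp
qed

section \<open>Boundaries of total zero and group connectivity modulo 3\<close>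

definition zero_sum :: "'v set \<Rightarrow> ('v \<Rightarrow> int) \<Rightarrow> bool" where
  "zero_sum V \<beta> \<longleftrightarrow> (\<forall>u. u \<notin> V \<longrightarrow> 3 dvd \<beta> u) \<and> 3 dvd sum \<beta> V"

lemma sum_of_bool_mult:
  fixes \<phi> :: "'v \<Rightarrow> int"
  assumes "finite V" "a \<in> V"
  shows "(\<Sum>u\<in>V. of_bool (u = a) * \<phi> u) = \<phi> a"
proof -
  have "(\<Sum>u\<in>V. of_bool (u = a) * \<phi> u) = (\<Sum>u\<in>V. if u = a then \<phi> u else 0)"
    by (rule sum.cong) auto
  then show ?thesis using assms by simp
qed

text \<open>Orienting an edge shifts the pairing of the boundary with a weight \<open>\<phi>\<close>
  by the difference of \<open>\<phi>\<close> at the two ends. With constant weight 1 there is no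
  shift, so the total is preserved.\<close>

lemma sum_arc:
  assumes "finite V" "a \<in> V" "b \<in> V"
  shows "(\<Sum>u\<in>V. \<phi> u * (\<beta> u - s * arc a b u)) = (\<Sum>u\<in>V. \<phi> u * \<beta> u) - s * (\<phi> a - \<phi> b)"
proof -
  have "(\<Sum>u\<in>V. \<phi> u * (\<beta> u - s * arc a b u)) =
    (\<Sum>u\<in>V. \<phi> u * \<beta> u - s * (of_bool (u = a) * \<phi> u) + s * (of_bool (u = b) * \<phi> u))"
    by (rule sum.cong) (auto simp: arc_def algebra_simps)
  also have "\<dots> = (\<Sum>u\<in>V. \<phi> u * \<beta> u) - s * (\<Sum>u\<in>V. of_bool (u = a) * \<phi> u)
      + s * (\<Sum>u\<in>V. of_bool (u = b) * \<phi> u)"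
    by (simp add: sum.distrib sum_subtractf sum_distrib_left)
  also have "\<dots> = (\<Sum>u\<in>V. \<phi> u * \<beta> u) - s * (\<phi> a - \<phi> b)"
    using assms by (simp add: sum_of_bool_mult right_diff_distrib)
  finally show ?thesis .
qed

lemma zero_sum_arc:
  assumes "finite V" "a \<in> V" "b \<in> V" "zero_sum V \<beta>"
  shows "zero_sum V (\<lambda>u. \<beta> u - s * arc a b u)"
  using sum_arc[OF assms(1-3), of "\<lambda>_. 1" \<beta> s] assms by (auto simp: zero_sum_def arc_def)

text \<open>Group connectivity for the integers modulo 3: a nonzero residue on an edge is a sign,
  that is, a choice of direction.\<close>

definition Z3_connected :: "('e \<Rightarrow> 'v set) \<Rightarrow> 'v set \<Rightarrow> 'e set \<Rightarrow> bool" where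
  "Z3_connected en V E \<longleftrightarrow> (\<forall>\<beta>. zero_sum V \<beta> \<longrightarrow> orientable en E \<beta>)"

lemma Z3_connected_zero: "Z3_connected en V E \<Longrightarrow> orientable en E (\<lambda>_. 0)"
  by (simp add: Z3_connected_def zero_sum_def)

definition edges_on :: "('e \<Rightarrow> 'v set) \<Rightarrow> 'v set \<Rightarrow> 'e set \<Rightarrow> bool" where
  "edges_on en V E \<longleftrightarrow> finite V \<and> finite E \<and> (\<forall>e\<in>E. \<exists>a\<in>V. \<exists>b\<in>V. a \<noteq> b \<and> en e = {a, b})"

lemma edges_onE:
  assumes "edges_on en V E" "e \<in> E"
  obtains a b where "a \<in> V" "b \<in> V" "en e = {a, b}" "a \<noteq> b"
  using assms unfolding edges_on_def by blast

text \<open>Additional edges may be oriented arbitrarily, because the corrected boundary still has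
  total 0 and is realised by the smaller edge set.\<close>

lemma Z3_connected_mono:
  assumes "Z3_connected en V E" "edges_on en V E'" "E \<subseteq> E'"
  shows "Z3_connected en V E'"
proof -
  have V: "finite V" and "finite (E' - E)" and "finite E"
    using assms by (auto simp: edges_on_def intro: finite_subset)
  have "finite X \<Longrightarrow> X \<subseteq> E' - E \<Longrightarrow> Z3_connected en V (X \<union> E)" for X
  proof (induction X rule: finite_induct)
    case empty
    then show ?case using assms by simp
  next
    case (insert e X)
    then obtain a b where ab: "a \<in> V" "b \<in> V" "en e = {a, b}"
      using assms(2) by (fastforce simp: edges_on_def)
    have IH: "Z3_connected en V (X \<union> E)" using insert by auto
    show ?case
      unfolding Z3_connected_def
    proof (intro allI impI)
      fix \<beta> assume "zero_sum V \<beta>"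
      then have "zero_sum V (\<lambda>u. \<beta> u - 1 * arc a b u)"
        by (intro zero_sum_arc V ab)
      then have "orientable en (X \<union> E) (\<lambda>u. \<beta> u - 1 * arc a b u)"
        using IH by (auto simp: Z3_connected_def)
      then show "orientable en (insert e X \<union> E) \<beta>"
        using orientable_insertI[of en "X \<union> E" \<beta> 1 a b e] insert \<open>finite E\<close> ab by auto
    qed
  qed
  from this[of "E' - E"] show ?thesis
    using assms \<open>finite (E' - E)\<close> by (simp add: Un_absorb1 Un_commute)
qed

section \<open>Edges that change the pairing with a weight\<close>

definition splits :: "('e \<Rightarrow> 'v set) \<Rightarrow> ('v \<Rightarrow> int) \<Rightarrow> 'e \<Rightarrow> bool" where
  "splits en \<phi> e \<longleftrightarrow> (\<exists>a b. en e = {a, b} \<and> \<not> 3 dvd \<phi> a - \<phi> b)"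

lemma splits_iff:
  assumes "en e = {a, b}"
  shows "splits en \<phi> e \<longleftrightarrow> \<not> 3 dvd \<phi> a - \<phi> b"
proof -
  have "3 dvd \<phi> a - \<phi> b \<longleftrightarrow> 3 dvd \<phi> b - \<phi> a" by presburger
  then show ?thesis
    using assms by (auto simp: splits_def doubleton_eq_iff)
qed

text \<open>An unsplit edge leaves the pairing unchanged modulo 3 in either direction. All
  additional edges can thus be oriented arbitrarily, and \<open>E\<close> realises the rest.\<close>

lemma orientable_no_split:
  assumes "edges_on en V E'" "E \<subseteq> E'"
    and E: "\<And>\<beta>. zero_sum V \<beta> \<Longrightarrow> 3 dvd (\<Sum>u\<in>V. \<phi> u * \<beta> u) \<Longrightarrow> orientable en E \<beta>"
    and "\<forall>e\<in>E' - E. \<not> splits en \<phi> e"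
    and "zero_sum V \<beta>" "3 dvd (\<Sum>u\<in>V. \<phi> u * \<beta> u)"
  shows "orientable en E' \<beta>"
proof -
  have V: "finite V" and fin: "finite (E' - E)" and "finite E"
    using assms by (auto simp: edges_on_def intro: finite_subset)
  have "finite X \<Longrightarrow> X \<subseteq> E' - E \<Longrightarrow> zero_sum V \<beta> \<Longrightarrow> 3 dvd (\<Sum>u\<in>V. \<phi> u * \<beta> u) \<Longrightarrow>
    orientable en (X \<union> E) \<beta>" for X \<beta>
  proof (induction X arbitrary: \<beta> rule: finite_induct)
    case empty
    then show ?case using E by simp
  next
    case (insert e X)
    then obtain a b where ab: "a \<in> V" "b \<in> V" "en e = {a, b}"
      using assms(1) by (fastforce simp: edges_on_def)
    have d: "3 dvd \<phi> a - \<phi> b"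
      using insert.prems(1) assms(4) splits_iff[of en e a b \<phi>] ab by auto
    have "orientable en (X \<union> E) (\<lambda>u. \<beta> u - 1 * arc a b u)"
    proof (rule insert.IH)
      show "zero_sum V (\<lambda>u. \<beta> u - 1 * arc a b u)"
        using insert.prems by (intro zero_sum_arc V ab)
      show "3 dvd (\<Sum>u\<in>V. \<phi> u * (\<beta> u - 1 * arc a b u))"
        unfolding sum_arc[OF V ab(1,2)] using d insert.prems(3) by simp
    qed (use insert.prems in auto)
    then show ?case
      using orientable_insertI[of en "X \<union> E" \<beta> 1 a b e] insert \<open>finite E\<close> ab by auto
  qed
  from this[of "E' - E" \<beta>] show ?thesis
    using assms fin by (simp add: Un_absorb1 Un_commute)
qed

text \<open>Two independent signs reach every residue modulo 3.\<close>

lemma Z3_connected_two_splits: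
  assumes "edges_on en V E'" "E \<subseteq> E'"
    and E: "\<And>\<beta>. zero_sum V \<beta> \<Longrightarrow> 3 dvd (\<Sum>u\<in>V. \<phi> u * \<beta> u) \<Longrightarrow> orientable en E \<beta>"
    and "e1 \<in> E' - E" "e2 \<in> E' - E" "e1 \<noteq> e2" "splits en \<phi> e1" "splits en \<phi> e2"
  shows "Z3_connected en V E'"
proof -
  have V: "finite V" and finE: "finite E"
    using assms by (auto simp: edges_on_def intro: finite_subset)
  obtain a b where ab: "a \<in> V" "b \<in> V" "en e1 = {a, b}"
    using assms(1,4) by (fastforce simp: edges_on_def)
  obtain c d where cd: "c \<in> V" "d \<in> V" "en e2 = {c, d}"
    using assms(1,5) by (fastforce simp: edges_on_def)
  have nab: "\<not> 3 dvd \<phi> a - \<phi> b" and ncd: "\<not> 3 dvd \<phi> c - \<phi> d"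
    using assms(7,8) ab(3) cd(3) by (auto simp: splits_iff)
  have "Z3_connected en V (insert e1 (insert e2 E))"
    unfolding Z3_connected_def
  proof (intro allI impI)
    fix \<beta> assume \<beta>: "zero_sum V \<beta>"
    define x where "x = (\<Sum>u\<in>V. \<phi> u * \<beta> u)"
    have signs: "\<exists>s\<in>{1, -1}. \<exists>s'\<in>{1, -1}. 3 dvd r - s * p - s' * q"
      if "\<not> 3 dvd p" "\<not> 3 dvd q" for r p q :: int
      using that by (simp; presburger)
    obtain s s' :: int where s: "s \<in> {1, -1}" "s' \<in> {1, -1}"
      and dvd: "3 dvd x - s * (\<phi> a - \<phi> b) - s' * (\<phi> c - \<phi> d)"
      using signs[OF nab ncd, of x] by blast
    have "orientable en E (\<lambda>u. (\<beta> u - s * arc a b u) - s' * arc c d u)"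
    proof (rule E)
      show "zero_sum V (\<lambda>u. \<beta> u - s * arc a b u - s' * arc c d u)"
        using \<beta> by (intro zero_sum_arc V ab cd)
      show "3 dvd (\<Sum>u\<in>V. \<phi> u * (\<beta> u - s * arc a b u - s' * arc c d u))"
        unfolding sum_arc[OF V cd(1,2)] sum_arc[OF V ab(1,2)] using dvd by (simp add: x_def)
    qed
    then have "orientable en (insert e2 E) (\<lambda>u. \<beta> u - s * arc a b u)"
      by (rule orientable_insertI[where s = s' and a = c and b = d]) (use s finE assms cd in auto)
    then show "orientable en (insert e1 (insert e2 E)) \<beta>"
      by (rule orientable_insertI[where s = s and a = a and b = b]) (use s finE assms ab in auto)
  qed
  then show ?thesis
    by (rule Z3_connected_mono) (use assms in auto)
qed

text \<open>The two directions of a split edge lead to two different residues of the pairing, at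
  most one of which is 0.\<close>

lemma Z3_connected_one_split:
  assumes "edges_on en V E'" "E \<subseteq> E'"
    and E: "\<And>\<beta>. zero_sum V \<beta> \<Longrightarrow> \<not> 3 dvd (\<Sum>u\<in>V. \<phi> u * \<beta> u) \<Longrightarrow> orientable en E \<beta>"
    and "e \<in> E' - E" "splits en \<phi> e"
  shows "Z3_connected en V E'"
proof -
  have V: "finite V" and finE: "finite E"
    using assms by (auto simp: edges_on_def intro: finite_subset)
  obtain a b where ab: "a \<in> V" "b \<in> V" "en e = {a, b}"
    using assms(1,4) by (fastforce simp: edges_on_def)
  have nab: "\<not> 3 dvd \<phi> a - \<phi> b"
    using assms(5) ab(3) by (auto simp: splits_iff)
  have "Z3_connected en V (insert e E)"
    unfolding Z3_connected_def
  proof (intro allI impI)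
    fix \<beta> assume \<beta>: "zero_sum V \<beta>"
    define x where "x = (\<Sum>u\<in>V. \<phi> u * \<beta> u)"
    have signs: "\<exists>s\<in>{1, -1}. \<not> 3 dvd r - s * p"
      if "\<not> 3 dvd p" for r p :: int
      using that by (simp; presburger)
    obtain s :: int where s: "s \<in> {1, -1}" and dvd: "\<not> 3 dvd x - s * (\<phi> a - \<phi> b)"
      using signs[OF nab, of x] by blast
    have "orientable en E (\<lambda>u. \<beta> u - s * arc a b u)"
    proof (rule E)
      show "zero_sum V (\<lambda>u. \<beta> u - s * arc a b u)"
        using \<beta> by (intro zero_sum_arc V ab)
      show "\<not> 3 dvd (\<Sum>u\<in>V. \<phi> u * (\<beta> u - s * arc a b u))"
        unfolding sum_arc[OF V ab(1,2)] using dvd by (simp add: x_def)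
    qed
    then show "orientable en (insert e E) \<beta>"
      by (rule orientable_insertI[where s = s and a = a and b = b]) (use s finE assms ab in auto)
  qed
  then show ?thesis
    by (rule Z3_connected_mono) (use assms in auto)
qed

section \<open>Triangle-trees with named edges\<close>

text \<open>Starting from a single edge rather than a triangle makes every vertex outside the first edge
  enter in the same way; triangle-trees are the two-trees with at least three vertices.\<close>

inductive two_tree :: "('e \<Rightarrow> 'v set) \<Rightarrow> 'v set \<Rightarrow> 'e set \<Rightarrow> bool" for en where
  edge: "\<lbrakk> a \<noteq> b; en e = {a, b} \<rbrakk> \<Longrightarrow> two_tree en {a, b} {e}"
| attach: "\<lbrakk> two_tree en V E; e0 \<in> E; en e0 = {y, z}; x \<notin> V; e1 \<notin> E; e2 \<notin> E; e1 \<noteq> e2;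
     en e1 = {x, y}; en e2 = {x, z} \<rbrakk> \<Longrightarrow> two_tree en (insert x V) (insert e1 (insert e2 E))"

lemma two_tree_edges_on: "two_tree en V E \<Longrightarrow> edges_on en V E"
proof (induction rule: two_tree.induct)
  case (attach V E e0 y z x e1 e2)
  then obtain a b where ab: "a \<in> V" "b \<in> V" "a \<noteq> b" "en e0 = {a, b}"
    unfolding edges_on_def by blast
  then have "y \<in> V" "z \<in> V" using attach.hyps by auto
  moreover have "x \<noteq> y" "x \<noteq> z" using calculation attach.hyps by auto
  moreover have "\<exists>a\<in>insert x V. \<exists>b\<in>insert x V. a \<noteq> b \<and> en e = {a, b}" if "e \<in> E" for e
    using attach.IH that unfolding edges_on_def by blast
  ultimately show ?case
    using attach.IH attach.hyps unfolding edges_on_def by blast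
next
  case (edge a b e)
  then show ?case
    by (auto simp: edges_on_def doubleton_eq_iff)
qed

lemma edges_on_edge:
  assumes "edges_on en V E" "e \<in> E" "en e = {y, z}"
  shows "y \<in> V" "z \<in> V" "y \<noteq> z"
  using edges_onE[OF assms(1,2)] assms(3) by (metis doubleton_eq_iff)+

definition proper3 :: "('e \<Rightarrow> 'v set) \<Rightarrow> 'e set \<Rightarrow> ('v \<Rightarrow> int) \<Rightarrow> bool" where
  "proper3 en E \<kappa> \<longleftrightarrow> (\<forall>e\<in>E. splits en \<kappa> e)"

lemma proper3D: "proper3 en E \<kappa> \<Longrightarrow> e \<in> E \<Longrightarrow> en e = {y, z} \<Longrightarrow> \<not> 3 dvd \<kappa> y - \<kappa> z"
  by (auto simp: proper3_def splits_iff)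

lemma two_tree_proper3: "two_tree en V E \<Longrightarrow> \<exists>\<kappa>. proper3 en E \<kappa>"
proof (induction rule: two_tree.induct)
  case (edge a b e)
  then have "proper3 en {e} (\<lambda>u. of_bool (u = a))"
    by (auto simp: proper3_def splits_iff)
  then show ?case by (rule exI[of _ "\<lambda>u. of_bool (u = a)"])
next
  case (attach V E e0 y z x e1 e2)
  note on = two_tree_edges_on[OF attach.hyps(1)]
  note yz = edges_on_edge[OF on attach.hyps(2,3)]
  have xyz: "x \<noteq> y" "x \<noteq> z" using yz attach.hyps(4) by auto
  obtain \<kappa> where \<kappa>: "proper3 en E \<kappa>" using attach.IH by blast
  have d: "\<not> 3 dvd \<kappa> y - \<kappa> z" using proper3D[OF \<kappa>] attach.hyps by blast
  \<comment> \<open>The residue different from both \<open>\<kappa> y\<close> and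
    \<open>\<kappa> z\<close>, since three distinct residues modulo 3 sum to 0.\<close>
  define \<kappa>' where "\<kappa>' = \<kappa>(x := - \<kappa> y - \<kappa> z)"
  have eq: "\<kappa>' u = \<kappa> u" if "u \<in> V" for u
  proof -
    have "u \<noteq> x" using that attach.hyps(4) by blast
    then show ?thesis by (simp add: \<kappa>'_def)
  qed
  have "splits en \<kappa>' e" if e: "e \<in> E" for e
  proof -
    obtain a b where ab: "a \<in> V" "b \<in> V" "en e = {a, b}" "a \<noteq> b"
      using on e by (rule edges_onE)
    show ?thesis
      using proper3D[of en E \<kappa> e a b, OF \<kappa> e ab(3)] eq ab(1,2) by (simp add: splits_iff[of en e a b, OF ab(3)])
  qed
  moreover have "splits en \<kappa>' e1"
  proof -
    have "\<not> 3 dvd (- \<kappa> y - \<kappa> z) - \<kappa> y" using d by presburger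
    then show ?thesis
      using xyz by (simp add: splits_iff[of en e1 x y, OF attach.hyps(8)] \<kappa>'_def)
  qed
  moreover have "splits en \<kappa>' e2"
  proof -
    have "\<not> 3 dvd (- \<kappa> y - \<kappa> z) - \<kappa> z" using d by presburger
    then show ?thesis
      using xyz by (simp add: splits_iff[of en e2 x z, OF attach.hyps(9)] \<kappa>'_def)
  qed
  ultimately have "proper3 en (insert e1 (insert e2 E)) \<kappa>'"
    by (auto simp: proper3_def)
  then show ?case by (rule exI[of _ \<kappa>'])
qed

section \<open>Orienting a two-tree by removing its last vertex\<close>

text \<open>The function under the sum is the boundary that remains for \<open>V\<close> after
  \<open>x\<close> is removed: edges from \<open>x\<close> to \<open>y\<close> and \<open>z\<close>,
  taken with signs \<open>s\<close> and \<open>s'\<close>, leave these signs at their other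
  ends.\<close>

lemma sum_push:
  fixes \<phi> :: "'v \<Rightarrow> int"
  assumes "finite V" "y \<in> V" "z \<in> V" "x \<notin> V"
  shows "(\<Sum>u\<in>V. \<phi> u * (if u = x then 0 else \<beta> u + s * of_bool (u = y) + s' * of_bool (u = z))) =
    (\<Sum>u\<in>V. \<phi> u * \<beta> u) + s * \<phi> y + s' * \<phi> z"
proof -
  have "(\<Sum>u\<in>V. \<phi> u * (if u = x then 0 else \<beta> u + s * of_bool (u = y) + s' * of_bool (u = z))) =
    (\<Sum>u\<in>V. \<phi> u * \<beta> u + s * (of_bool (u = y) * \<phi> u) + s' * (of_bool (u = z) * \<phi> u))"
    using assms(4) by (intro sum.cong) (auto simp: algebra_simps)
  also have "\<dots> = (\<Sum>u\<in>V. \<phi> u * \<beta> u) + s * (\<Sum>u\<in>V. of_bool (u = y) * \<phi> u)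
      + s' * (\<Sum>u\<in>V. of_bool (u = z) * \<phi> u)"
    by (simp add: sum.distrib sum_distrib_left)
  also have "\<dots> = (\<Sum>u\<in>V. \<phi> u * \<beta> u) + s * \<phi> y + s' * \<phi> z"
    using assms by (simp add: sum_of_bool_mult)
  finally show ?thesis .
qed

lemma zero_sum_push:
  assumes "finite V" "y \<in> V" "z \<in> V" "x \<notin> V" "zero_sum (insert x V) \<beta>" "3 dvd s + s' - \<beta> x"
  shows "zero_sum V (\<lambda>u. if u = x then 0 else \<beta> u + s * of_bool (u = y) + s' * of_bool (u = z))"
proof -
  have "3 dvd sum \<beta> V + s + s'"
  proof -
    have "3 dvd \<beta> x + sum \<beta> V" using assms by (simp add: zero_sum_def)
    then show ?thesis using assms(6) by presburger
  qed
  then show ?thesis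
    using sum_push[OF assms(1-4), of "\<lambda>_. 1" \<beta> s s'] assms(2-5)
    by (auto simp: zero_sum_def)
qed

lemma orientable_attach:
  assumes "orientable en E (\<lambda>u. if u = x then 0 else \<beta> u + s * of_bool (u = y) + s' * of_bool (u = z))"
    and "s = 1 \<or> s = -1" "s' = 1 \<or> s' = -1" "3 dvd s + s' - \<beta> x"
    and "finite E" "e1 \<notin> E" "e2 \<notin> E" "e1 \<noteq> e2" "en e1 = {x, y}" "en e2 = {x, z}" "x \<noteq> y" "x \<noteq> z"
  shows "orientable en (insert e1 (insert e2 E)) \<beta>"
proof (rule orientable_insertI[where s = s and a = x and b = y])
  show "orientable en (insert e2 E) (\<lambda>u. \<beta> u - s * arc x y u)"
  proof (rule orientable_insertI[where s = s' and a = x and b = z])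
    have "3 dvd - (s + s' - \<beta> x)" using assms(4) by (rule dvd_minus_iff[THEN iffD2])
    then show "orientable en E (\<lambda>u. \<beta> u - s * arc x y u - s' * arc x z u)"
      by (intro orientable_cong[OF assms(1)])
        (use assms(4,11,12) in \<open>auto simp: arc_def algebra_simps\<close>)
  qed (use assms in auto)
qed (use assms in auto)

text \<open>A proper colouring modulo 3 sums to 0 on every triangle, so the pairing of \<open>\<kappa>\<close> with the
  boundary survives the removal of a degree-2 vertex with forced orientation.\<close>

lemma two_tree_orientable:
  assumes "two_tree en V E" "proper3 en E \<kappa>" "zero_sum V \<beta>" "\<not> 3 dvd (\<Sum>u\<in>V. \<kappa> u * \<beta> u)"
  shows "orientable en E \<beta>"
  using assms
proof (induction arbitrary: \<beta> rule: two_tree.induct)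
  case (edge a b e)
  then have ab: "3 dvd \<beta> a + \<beta> b" "\<not> 3 dvd \<kappa> a * \<beta> a + \<kappa> b * \<beta> b"
    by (auto simp: zero_sum_def)
  \<comment> \<open>The boundary values at \<open>a\<close> and \<open>b\<close> are opposite modulo
    3, so the pairing is \<open>(\<kappa> a - \<kappa> b) * \<beta> a\<close> there. It is nonzero,
    hence \<open>\<beta> a\<close> is a sign and directs the edge.\<close>
  have "\<kappa> a * \<beta> a + \<kappa> b * \<beta> b = (\<kappa> a - \<kappa> b) * \<beta> a + \<kappa> b * (\<beta> a + \<beta> b)"
    by (simp add: algebra_simps)
  with ab have n: "\<not> 3 dvd \<beta> a" by (metis dvd_add dvd_mult)
  then have "3 dvd \<beta> a - 1 \<or> 3 dvd \<beta> a - (-1)" by presburger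
  then obtain s where s: "s = 1 \<or> s = -1" "3 dvd \<beta> a - s" by blast
  show ?case
  proof (rule orientable_insertI[where s = s and a = a and b = b])
    have "3 dvd \<beta> b + s" using s ab(1) by presburger
    then show "orientable en {} (\<lambda>u. \<beta> u - s * arc a b u)"
      using edge s by (auto simp: orientable_empty arc_def zero_sum_def)
  qed (use edge s in auto)
next
  case (attach V E e0 y z x e1 e2)
  note on = two_tree_edges_on[OF attach.hyps(1)]
  note yz = edges_on_edge[OF on attach.hyps(2,3)]
  have xyz: "x \<noteq> y" "x \<noteq> z" using yz attach by auto
  have fin: "finite V" "finite E" using on by (auto simp: edges_on_def)
  have \<kappa>: "proper3 en E \<kappa>" using attach.prems by (auto simp: proper3_def)
  have d: "\<not> 3 dvd \<kappa> y - \<kappa> z" "\<not> 3 dvd \<kappa> x - \<kappa> y" "\<not> 3 dvd \<kappa> x - \<kappa> z"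
    using proper3D[OF attach.prems(1)] attach.hyps by blast+
  have \<Phi>: "\<not> 3 dvd (\<Sum>u\<in>V. \<kappa> u * \<beta> u) + \<kappa> x * \<beta> x"
    using attach.prems(3) attach.hyps fin by (simp add: add.commute)
  \<comment> \<open>If \<open>\<beta> x\<close> is 0 modulo 3, the signs are opposite, and the two
    choices yield pairings that differ by twice \<open>\<kappa> y - \<kappa> z\<close>. Otherwise
    both signs are forced to be \<open>- \<beta> x\<close>, and the pairing is preserved because
    \<open>\<kappa> x + \<kappa> y + \<kappa> z\<close> is 0.\<close>
  have "\<exists>s\<in>{1, -1}. \<exists>s'\<in>{1, -1}. 3 dvd s + s' - \<beta> x \<and>
      \<not> 3 dvd (\<Sum>u\<in>V. \<kappa> u * \<beta> u) + s * \<kappa> y + s' * \<kappa> z"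
  proof -
    have "\<exists>s\<in>{1, -1}. \<exists>s'\<in>{1, -1}. 3 dvd s + s' - b \<and> \<not> 3 dvd S + s * ky + s' * kz"
      if "\<not> 3 dvd ky - kz" "\<not> 3 dvd kx - ky" "\<not> 3 dvd kx - kz" "\<not> 3 dvd S + kx * b"
      for b S kx ky kz :: int
    proof -
      have "\<exists>q. b = 3 * q \<or> b = 3 * q + 1 \<or> b = 3 * q - 1" by presburger
      then obtain q where "b = 3 * q \<or> b = 3 * q + 1 \<or> b = 3 * q - 1" ..
      then consider "b = 3 * q" | "b = 3 * q + 1" | "b = 3 * q - 1" by blast
      then show ?thesis
      proof cases
        case 1
        have "\<not> 3 dvd S + ky - kz \<or> \<not> 3 dvd S - ky + kz"
          using that(1) by presburger
        then show ?thesis using 1 by auto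
      next
        case 2
        have "S + kx * b = S + kx + 3 * (kx * q)" unfolding 2 by (simp add: algebra_simps)
        then have "\<not> 3 dvd S + kx" using that(4) by presburger
        then have "\<not> 3 dvd S - ky - kz" using that(1-3) by presburger
        then have "3 dvd (-1) + (-1) - b \<and> \<not> 3 dvd S + (-1) * ky + (-1) * kz"
          using 2 by simp
        then show ?thesis by blast
      next
        case 3
        have "S + kx * b = S - kx + 3 * (kx * q)" unfolding 3 by (simp add: algebra_simps)
        then have "\<not> 3 dvd S - kx" using that(4) by presburger
        then have "\<not> 3 dvd S + ky + kz" using that(1-3) by presburger
        then have "3 dvd 1 + 1 - b \<and> \<not> 3 dvd S + 1 * ky + 1 * kz"
          using 3 by simp
        then show ?thesis by blast
      qed
    qed
    from this[OF d \<Phi>] show ?thesis .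
  qed
  then obtain s s' :: int where s: "s \<in> {1, -1}" "s' \<in> {1, -1}" "3 dvd s + s' - \<beta> x"
    "\<not> 3 dvd (\<Sum>u\<in>V. \<kappa> u * \<beta> u) + s * \<kappa> y + s' * \<kappa> z" by blast
  show ?case
  proof (rule orientable_attach)
    show "orientable en E (\<lambda>u. if u = x then 0 else \<beta> u + s * of_bool (u = y) + s' * of_bool (u = z))"
    proof (rule attach.IH[OF \<kappa>])
      show "zero_sum V (\<lambda>u. if u = x then 0 else \<beta> u + s * of_bool (u = y) + s' * of_bool (u = z))"
        by (rule zero_sum_push) (use fin yz attach.hyps attach.prems s in blast)+
      show "\<not> 3 dvd (\<Sum>u\<in>V. \<kappa> u * (if u = x then 0
          else \<beta> u + s * of_bool (u = y) + s' * of_bool (u = z)))"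
        unfolding sum_push[OF fin(1) yz(1,2) attach.hyps(4)] by (rule s(4))
    qed
  qed (use s fin xyz attach.hyps in \<open>blast | simp\<close>)+
qed

text \<open>The two edges at \<open>x\<close> form a path through \<open>x\<close> that can run
  either way. The two directions give different pairings with a proper colouring of the rest, so one
  pairing is nonzero and \<open>two_tree_orientable\<close> applies.\<close>

lemma two_tree_attach_orientable_zero:
  assumes "two_tree en V E" "e0 \<in> E" "en e0 = {y, z}" "x \<notin> V" "e1 \<notin> E" "e2 \<notin> E" "e1 \<noteq> e2"
    "en e1 = {x, y}" "en e2 = {x, z}"
    and "zero_sum (insert x V) \<beta>" "3 dvd \<beta> x"
  shows "orientable en (insert e1 (insert e2 E)) \<beta>"
proof -
  note on = two_tree_edges_on[OF assms(1)]
  note yz = edges_on_edge[OF on assms(2,3)]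
  have xyz: "x \<noteq> y" "x \<noteq> z" using yz assms by auto
  have fin: "finite V" "finite E" using on by (auto simp: edges_on_def)
  obtain \<kappa> where \<kappa>: "proper3 en E \<kappa>" using two_tree_proper3[OF assms(1)] ..
  have "\<not> 3 dvd \<kappa> y - \<kappa> z" using proper3D[OF \<kappa>] assms(2,3) by blast
  then have "\<not> 3 dvd (\<Sum>u\<in>V. \<kappa> u * \<beta> u) + \<kappa> y - \<kappa> z \<or> \<not> 3 dvd (\<Sum>u\<in>V. \<kappa> u * \<beta> u) - \<kappa> y + \<kappa> z"
    by presburger
  then obtain s :: int where s: "s = 1 \<or> s = -1"
    "\<not> 3 dvd (\<Sum>u\<in>V. \<kappa> u * \<beta> u) + s * \<kappa> y + (- s) * \<kappa> z"
    by force
  show ?thesis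
  proof (rule orientable_attach)
    show "orientable en E (\<lambda>u. if u = x then 0 else \<beta> u + s * of_bool (u = y) + (- s) * of_bool (u = z))"
    proof (rule two_tree_orientable[OF assms(1) \<kappa>])
      show "zero_sum V (\<lambda>u. if u = x then 0 else \<beta> u + s * of_bool (u = y) + (- s) * of_bool (u = z))"
        by (rule zero_sum_push) (use fin yz assms s in \<open>blast | simp\<close>)+
      show "\<not> 3 dvd (\<Sum>u\<in>V. \<kappa> u * (if u = x then 0
          else \<beta> u + s * of_bool (u = y) + (- s) * of_bool (u = z)))"
        unfolding sum_push[OF fin(1) yz(1,2) assms(4)] by (rule s(2))
    qed
  qed (use s fin xyz assms in auto)
qed

text \<open>If \<open>\<beta> x\<close> is nonzero modulo 3, both edges at \<open>x\<close> carry
  the same sign \<open>s\<close>, with \<open>2 * s\<close> congruent to \<open>\<beta> x\<close>,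
  hence \<open>s\<close> congruent to \<open>- \<beta> x\<close>. This is the value passed on to
  \<open>y\<close> and \<open>z\<close>.\<close>

lemma two_tree_attach_orientable:
  assumes "two_tree en V E" "e0 \<in> E" "en e0 = {y, z}" "x \<notin> V" "e1 \<notin> E" "e2 \<notin> E" "e1 \<noteq> e2"
    "en e1 = {x, y}" "en e2 = {x, z}"
    and "zero_sum (insert x V) \<beta>"
    and or: "orientable en E (\<lambda>u. if u = x then 0
      else \<beta> u + (- \<beta> x) * of_bool (u = y) + (- \<beta> x) * of_bool (u = z))"
  shows "orientable en (insert e1 (insert e2 E)) \<beta>"
proof (cases "3 dvd \<beta> x")
  case True
  then show ?thesis by (rule two_tree_attach_orientable_zero[OF assms(1-10)])
next
  case False
  note on = two_tree_edges_on[OF assms(1)]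
  note yz = edges_on_edge[OF on assms(2,3)]
  have xyz: "x \<noteq> y" "x \<noteq> z" using yz assms by auto
  have fin: "finite V" "finite E" using on by (auto simp: edges_on_def)
  have "3 dvd \<beta> x + 1 \<or> 3 dvd \<beta> x + (-1)" using False by presburger
  then obtain s where s: "s = 1 \<or> s = -1" "3 dvd \<beta> x + s" by blast
  show ?thesis
  proof (rule orientable_attach)
    show "orientable en E (\<lambda>u. if u = x then 0 else \<beta> u + s * of_bool (u = y) + s * of_bool (u = z))"
    proof (rule orientable_cong[OF or])
      show "3 dvd (if u = x then 0 else \<beta> u + (- \<beta> x) * of_bool (u = y) + (- \<beta> x) * of_bool (u = z)) -
        (if u = x then 0 else \<beta> u + s * of_bool (u = y) + s * of_bool (u = z))" for u
        using s(2) by (auto; presburger)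
    qed
    show "3 dvd s + s - \<beta> x" using s(2) by presburger
  qed (use s fin xyz assms in auto)
qed

section \<open>Leaves around a common vertex\<close>

text \<open>A two-tree whose last vertices are a centre \<open>v\<close>, attached to the edge \<open>p q\<close> of the rest, and leaves
  \<open>x \<in> L\<close>, each attached by the edges \<open>f x\<close> and \<open>g x\<close> to one of the two new edges \<open>v p\<close> and \<open>v q\<close>.\<close>

locale fan =
  fixes en :: "'e \<Rightarrow> 'v set" and V0 E0 v p q e0 ep eq L f g r
  assumes base: "two_tree en V0 E0" "e0 \<in> E0" "en e0 = {p, q}"
    and center: "v \<notin> V0" "ep \<notin> E0" "eq \<notin> E0" "ep \<noteq> eq" "en ep = {v, p}" "en eq = {v, q}"
    and finite_leaves: "finite L" and leaves_new: "L \<inter> insert v V0 = {}"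
    and inj: "inj_on f L" "inj_on g L" "f ` L \<inter> g ` L = {}"
    and leaf_edges_new: "(f ` L \<union> g ` L) \<inter> insert ep (insert eq E0) = {}"
    and ends_f: "x \<in> L \<Longrightarrow> en (f x) = {x, v}"
    and ends_g: "x \<in> L \<Longrightarrow> en (g x) = {x, r x}"
    and rim: "x \<in> L \<Longrightarrow> r x \<in> {p, q}"
begin

text \<open>The argument selects the leaves that are kept, so that leaves can be removed one at a
  time.\<close>

definition VL :: "'v set \<Rightarrow> 'v set" where
  "VL X = X \<union> insert v V0"

definition EL :: "'v set \<Rightarrow> 'e set" where
  "EL X = f ` X \<union> g ` X \<union> insert ep (insert eq E0)"

lemma pq: "p \<in> V0" "q \<in> V0" "p \<noteq> q"
  using edges_on_edge[of en V0 E0 e0 p q, OF two_tree_edges_on[OF base(1)] base(2,3)] .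

lemma finite_VL: "X \<subseteq> L \<Longrightarrow> finite (VL X)"
  using finite_leaves two_tree_edges_on[OF base(1)]
  by (auto simp: VL_def edges_on_def intro: finite_subset)

lemma two_tree_core: "two_tree en (VL {}) (EL {})"
  using two_tree.attach[of en V0 E0 e0 p q v ep eq, OF base center] by (simp add: VL_def EL_def)

text \<open>The edge below a leaf is \<open>ep\<close> or \<open>eq\<close>, hence present for every
  choice of \<open>X\<close>. The leaves can therefore be attached in any order.\<close>

lemma spine: "x \<in> L \<Longrightarrow> \<exists>e\<in>EL X. en e = {v, r x}"
  using rim[of x] center by (auto simp: EL_def)

lemma leaf_fresh:
  assumes "x \<in> L" "X \<subseteq> L" "x \<notin> X"
  shows "x \<notin> VL X" "f x \<notin> EL X" "g x \<notin> EL X" "f x \<noteq> g x"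
proof -
  show "x \<notin> VL X" using assms leaves_new by (auto simp: VL_def)
  have x: "f x \<in> f ` L" "g x \<in> g ` L" and X: "f ` X \<subseteq> f ` L" "g ` X \<subseteq> g ` L"
    using assms by auto
  have "f x \<notin> f ` X" "g x \<notin> g ` X"
    using inj_on_image_mem_iff[OF inj(1) assms(1,2)] inj_on_image_mem_iff[OF inj(2) assms(1,2)]
      assms(3) by auto
  moreover have "f x \<notin> g ` X" "g x \<notin> f ` X" "f x \<noteq> g x"
    using x X inj(3) disjoint_iff by (metis subsetD)+
  moreover have "f x \<notin> insert ep (insert eq E0)" "g x \<notin> insert ep (insert eq E0)"
    using x leaf_edges_new by blast+
  ultimately show "f x \<notin> EL X" "g x \<notin> EL X" "f x \<noteq> g x"
    unfolding EL_def by blast+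
qed

lemma VL_insert: "VL (insert x X) = insert x (VL X)"
  by (auto simp: VL_def)

lemma EL_insert: "EL (insert x X) = insert (f x) (insert (g x) (EL X))"
  by (auto simp: EL_def)

lemma two_tree_sub:
  assumes "X \<subseteq> L"
  shows "two_tree en (VL X) (EL X)"
proof -
  have "finite X" using assms finite_leaves by (rule finite_subset)
  then show ?thesis
    using assms
  proof (induction X rule: finite_induct)
    case empty
    then show ?case using two_tree_core by simp
  next
    case (insert x X)
    then have x: "x \<in> L" "X \<subseteq> L" by auto
    obtain e where e: "e \<in> EL X" "en e = {v, r x}" using spine[OF x(1)] by blast
    show ?case
      unfolding VL_insert EL_insert
      by (rule two_tree.attach[of en "VL X" "EL X" e v "r x" x "f x" "g x", OF insert.IH[OF x(2)] e leaf_fresh[OF x insert.hyps(2)]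
            ends_f[OF x(1)] ends_g[OF x(1)]])
  qed
qed

text \<open>Every leaf can be taken as the last vertex of the two-tree, since no leaf is attached to
  another.\<close>

lemma leaf_orientable:
  assumes "x \<in> L" "zero_sum (VL L) \<beta>" "3 dvd \<beta> x"
  shows "orientable en (EL L) \<beta>"
proof -
  define X where "X = L - {x}"
  have X: "X \<subseteq> L" "x \<notin> X" and L: "L = insert x X" using assms(1) by (auto simp: X_def)
  obtain e where e: "e \<in> EL X" "en e = {v, r x}" using spine[OF assms(1)] by blast
  have "orientable en (insert (f x) (insert (g x) (EL X))) \<beta>"
    by (rule two_tree_attach_orientable_zero[of en "VL X" "EL X" e v "r x" x "f x" "g x" \<beta>, OF two_tree_sub[OF X(1)] e leaf_fresh[OF assms(1) X]
          ends_f[OF assms(1)] ends_g[OF assms(1)] _ assms(3)])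
      (use assms(2) L VL_insert in simp)
  then show ?thesis using L EL_insert by simp
qed

text \<open>Removing the leaves one by one pushes \<open>- \<beta> x\<close> onto the centre for every leaf \<open>x\<close>, which
  finally becomes a leaf itself.\<close>

lemma fan_orientable:
  assumes "X \<subseteq> L" "zero_sum (VL X) \<beta>" "3 dvd \<beta> v - sum \<beta> X"
  shows "orientable en (EL X) \<beta>"
proof -
  have "finite X" using assms finite_leaves by (blast intro: finite_subset)
  then show ?thesis
    using assms
  proof (induction X arbitrary: \<beta> rule: finite_induct)
    case empty
    have "orientable en (insert ep (insert eq E0)) \<beta>"
      by (rule two_tree_attach_orientable_zero[of en V0 E0 e0 p q v ep eq, OF base center])
        (use empty.prems in \<open>simp_all add: VL_def\<close>)
    then show ?case by (simp add: EL_def)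
  next
    case (insert x X)
    then have x: "x \<in> L" "X \<subseteq> L" by auto
    have neq: "x \<noteq> v" "v \<noteq> r x" "x \<noteq> r x" "r x \<in> V0"
      using x leaves_new pq center(1) rim[OF x(1)] by auto
    obtain e where e: "e \<in> EL X" "en e = {v, r x}" using spine[OF x(1)] by blast
    have V: "v \<in> VL X" "r x \<in> VL X" using neq by (auto simp: VL_def)
    have zs: "zero_sum (insert x (VL X)) \<beta>"
      using insert.prems(2) by (simp add: VL_insert)
    define \<gamma> where "\<gamma> = (\<lambda>u. if u = x then 0
      else \<beta> u + (- \<beta> x) * of_bool (u = v) + (- \<beta> x) * of_bool (u = r x))"
    \<comment> \<open>Neither \<open>v\<close> nor \<open>r x\<close> is a leaf, so the push alters
      no value at a remaining leaf and affects the difference only through the centre.\<close>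
    have outside: "u \<notin> X" if "u \<in> insert v V0" for u
      using that leaves_new x(2) by auto
    have "sum \<gamma> X = sum \<beta> X"
      by (rule sum.cong) (use insert.hyps outside neq in \<open>auto simp: \<gamma>_def\<close>)
    moreover have "\<gamma> v = \<beta> v - \<beta> x" using neq by (simp add: \<gamma>_def)
    ultimately have "\<gamma> v - sum \<gamma> X = \<beta> v - sum \<beta> (insert x X)"
      using insert.hyps by simp
    then have pair: "3 dvd \<gamma> v - sum \<gamma> X"
      using insert.prems(3) by simp
    have "zero_sum (VL X) \<gamma>"
      unfolding \<gamma>_def
      by (rule zero_sum_push[OF finite_VL[OF x(2)] V leaf_fresh(1)[OF x insert.hyps(2)] zs]) simp
    then have "orientable en (EL X) \<gamma>"
      by (rule insert.IH[OF x(2) _ pair])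
    then show ?case
      unfolding EL_insert \<gamma>_def
      by (rule two_tree_attach_orientable[of en "VL X" "EL X" e v "r x" x "f x" "g x", OF two_tree_sub[OF x(2)] e
            leaf_fresh[OF x insert.hyps(2)] ends_f[OF x(1)] ends_g[OF x(1)] zs])
  qed
qed

lemma fan_add_leaf:
  assumes "x \<notin> VL L" "e1 \<notin> EL L" "e2 \<notin> EL L" "e1 \<noteq> e2"
    "en e1 = {x, v}" "en e2 = {x, s}" "s \<in> {p, q}"
  shows "fan en V0 E0 v p q e0 ep eq (insert x L) (f(x := e1)) (g(x := e2)) (r(x := s))"
    and "fan.EL E0 ep eq (f(x := e1)) (g(x := e2)) (insert x L) = insert e1 (insert e2 (EL L))"
proof -
  have x: "x \<notin> L" "x \<notin> insert v V0" using assms(1) by (auto simp: VL_def)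
  have im: "f(x := e1) ` insert x L = insert e1 (f ` L)" "g(x := e2) ` insert x L = insert e2 (g ` L)"
    using x by auto
  have e: "e1 \<notin> f ` L" "e1 \<notin> g ` L" "e2 \<notin> f ` L" "e2 \<notin> g ` L"
    "e1 \<notin> insert ep (insert eq E0)" "e2 \<notin> insert ep (insert eq E0)"
    using assms(2,3) by (auto simp: EL_def)
  show fan: "fan en V0 E0 v p q e0 ep eq (insert x L) (f(x := e1)) (g(x := e2)) (r(x := s))"
  proof
    show "inj_on (f(x := e1)) (insert x L)" "inj_on (g(x := e2)) (insert x L)"
      using inj(1,2) x e by (auto simp: inj_on_def)
    show "f(x := e1) ` insert x L \<inter> g(x := e2) ` insert x L = {}"
      unfolding im using inj(3) e assms(4) by auto
    show "(f(x := e1) ` insert x L \<union> g(x := e2) ` insert x L) \<inter> insert ep (insert eq E0) = {}"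
      unfolding im using leaf_edges_new e by auto
    show "insert x L \<inter> insert v V0 = {}" using x leaves_new by auto
    show "en ((f(x := e1)) y) = {y, v}" if "y \<in> insert x L" for y
      using that assms(5) ends_f by (cases "y = x") auto
    show "en ((g(x := e2)) y) = {y, (r(x := s)) y}" if "y \<in> insert x L" for y
      using that assms(6) ends_g by (cases "y = x") auto
    show "(r(x := s)) y \<in> {p, q}" if "y \<in> insert x L" for y
      using that assms(7) rim by (cases "y = x") auto
  qed (use base center finite_leaves in auto)
  show "fan.EL E0 ep eq (f(x := e1)) (g(x := e2)) (insert x L) = insert e1 (insert e2 (EL L))"
    unfolding fan.EL_def[OF fan] im EL_def by auto
qed

lemma fan_grow_base:
  assumes "e \<in> E0" "en e = {y, z}" "x \<notin> VL L" "e1 \<notin> EL L" "e2 \<notin> EL L" "e1 \<noteq> e2"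
    "en e1 = {x, y}" "en e2 = {x, z}"
  shows "fan en (insert x V0) (insert e1 (insert e2 E0)) v p q e0 ep eq L f g r"
proof
  show "two_tree en (insert x V0) (insert e1 (insert e2 E0))"
    by (rule two_tree.attach[of en V0 E0 e y z x e1 e2, OF base(1)])
      (use assms in \<open>auto simp: VL_def EL_def\<close>)
  show "(f ` L \<union> g ` L) \<inter> insert ep (insert eq (insert e1 (insert e2 E0))) = {}"
    using leaf_edges_new assms(4,5) by (auto simp: EL_def)
  show "L \<inter> insert v (insert x V0) = {}"
    using leaves_new assms(3) by (auto simp: VL_def)
qed (use base center finite_leaves inj ends_f ends_g rim assms in \<open>auto simp: VL_def EL_def\<close>)

text \<open>A vertex attached to an edge at the leaf \<open>x\<close> turns \<open>x\<close> into
  the new centre, over the edge from \<open>v\<close> to \<open>r x\<close>. The old centre and the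
  other leaves join the base, and the new vertex is the only leaf.\<close>

lemma fan_shift:
  assumes "x \<in> L" "y \<notin> VL L" "e1 \<notin> EL L" "e2 \<notin> EL L" "e1 \<noteq> e2"
    "en e1 = {y, x}" "en e2 = {y, s}" "s \<in> {v, r x}"
  shows "\<exists>e. fan en (VL (L - {x})) (EL (L - {x})) x v (r x) e (f x) (g x) {y} (\<lambda>_. e1) (\<lambda>_. e2) (\<lambda>_. s)"
proof -
  define X where "X = L - {x}"
  have X: "X \<subseteq> L" "x \<notin> X" and L: "L = insert x X" using assms(1) by (auto simp: X_def)
  obtain e where e: "e \<in> EL X" "en e = {v, r x}" using spine[OF assms(1)] by blast
  have "y \<notin> insert x (VL X)" "e1 \<notin> insert (f x) (insert (g x) (EL X))"
    "e2 \<notin> insert (f x) (insert (g x) (EL X))"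
    using assms(2-4) unfolding L VL_insert EL_insert by auto
  then have "fan en (VL X) (EL X) x v (r x) e (f x) (g x) {y} (\<lambda>_. e1) (\<lambda>_. e2) (\<lambda>_. s)"
    using two_tree_sub[OF X(1)] e leaf_fresh[OF assms(1) X] ends_f[OF assms(1)] ends_g[OF assms(1)]
      assms(5-8)
    by unfold_locales auto
  then show ?thesis unfolding X_def ..
qed

end

section \<open>Every two-tree on at least four vertices ends in a fan\<close>

definition has_fan :: "('e \<Rightarrow> 'v set) \<Rightarrow> 'v set \<Rightarrow> 'e set \<Rightarrow> bool" where
  "has_fan en V E \<longleftrightarrow> (\<exists>V0 E0 v p q e0 ep eq L f g r. fan en V0 E0 v p q e0 ep eq L f g r \<and> L \<noteq> {} \<and>
     V = fan.VL V0 v L \<and> E = fan.EL E0 ep eq f g L)"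

lemma has_fanI:
  assumes "fan en V0 E0 v p q e0 ep eq L f g r" "L \<noteq> {}" "V = fan.VL V0 v L" "E = fan.EL E0 ep eq f g L"
  shows "has_fan en V E"
  using assms unfolding has_fan_def by blast

context fan
begin

lemma has_fan_add_leaf:
  assumes "x \<notin> VL L" "e1 \<notin> EL L" "e2 \<notin> EL L" "e1 \<noteq> e2"
    "en e1 = {x, v}" "en e2 = {x, s}" "s \<in> {p, q}"
  shows "has_fan en (insert x (VL L)) (insert e1 (insert e2 (EL L)))"
  by (rule has_fanI[OF fan_add_leaf(1)[OF assms]])
    (use fan_add_leaf(2)[OF assms] fan.VL_def[OF fan_add_leaf(1)[OF assms]]
      in \<open>auto simp: VL_def\<close>)

lemma has_fan_grow_base:
  assumes "e \<in> E0" "en e = {y, z}" "x \<notin> VL L" "e1 \<notin> EL L" "e2 \<notin> EL L" "e1 \<noteq> e2"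
    "en e1 = {x, y}" "en e2 = {x, z}" "L \<noteq> {}"
  shows "has_fan en (insert x (VL L)) (insert e1 (insert e2 (EL L)))"
proof -
  note fan = fan_grow_base[OF assms(1-8)]
  show ?thesis
    by (rule has_fanI[OF fan assms(9)])
      (auto simp: fan.VL_def[OF fan] fan.EL_def[OF fan] VL_def EL_def)
qed

lemma has_fan_shift:
  assumes "x \<in> L" "y \<notin> VL L" "e1 \<notin> EL L" "e2 \<notin> EL L" "e1 \<noteq> e2"
    "en e1 = {y, x}" "en e2 = {y, s}" "s \<in> {v, r x}"
  shows "has_fan en (insert y (VL L)) (insert e1 (insert e2 (EL L)))"
proof -
  obtain e where fan: "fan en (VL (L - {x})) (EL (L - {x})) x v (r x) e (f x) (g x) {y}
      (\<lambda>_. e1) (\<lambda>_. e2) (\<lambda>_. s)"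
    using fan_shift[OF assms] ..
  have "VL L = insert x (VL (L - {x}))" "EL L = insert (f x) (insert (g x) (EL (L - {x})))"
    using assms(1) by (simp_all add: VL_insert[symmetric] EL_insert[symmetric] insert_absorb)
  then show ?thesis
    by (intro has_fanI[OF fan]) (auto simp: fan.VL_def[OF fan] fan.EL_def[OF fan])
qed

text \<open>An edge of the fan meets a leaf, is one of the two centre edges, or lies in the base. A
  vertex attached to it respectively shifts the centre, becomes a further leaf, or enlarges the
  base.\<close>

lemma has_fan_attach:
  assumes "e \<in> EL L" "en e = {y, z}" "x \<notin> VL L" "e1 \<notin> EL L" "e2 \<notin> EL L" "e1 \<noteq> e2"
    "en e1 = {x, y}" "en e2 = {x, z}" "L \<noteq> {}"
  shows "has_fan en (insert x (VL L)) (insert e1 (insert e2 (EL L)))"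
proof -
  have leaf: ?thesis if "{y, z} = {v, s}" "s \<in> {p, q}" for s
  proof -
    consider "y = v" "z = s" | "y = s" "z = v"
      using \<open>{y, z} = {v, s}\<close> by (auto simp: doubleton_eq_iff)
    then show ?thesis
    proof cases
      case 1
      then show ?thesis using has_fan_add_leaf[of x e1 e2 s] assms that by auto
    next
      case 2
      then show ?thesis
        using has_fan_add_leaf[of x e2 e1 s] assms that by (auto simp: insert_commute)
    qed
  qed
  have shift: ?thesis if "{y, z} = {a, s}" "a \<in> L" "s \<in> {v, r a}" for a s
  proof -
    consider "y = a" "z = s" | "y = s" "z = a"
      using \<open>{y, z} = {a, s}\<close> by (auto simp: doubleton_eq_iff)
    then show ?thesis
    proof cases
      case 1
      then show ?thesis using has_fan_shift[of a x e1 e2 s] assms that by auto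
    next
      case 2
      then show ?thesis
        using has_fan_shift[of a x e2 e1 s] assms that by (auto simp: insert_commute)
    qed
  qed
  consider a where "a \<in> L" "e = f a \<or> e = g a" | "e = ep \<or> e = eq" | "e \<in> E0"
    using assms(1) by (auto simp: EL_def)
  then show ?thesis
  proof cases
    case 1
    then show ?thesis using shift[of a v] shift[of a "r a"] ends_f ends_g assms(2) by auto
  next
    case 2
    then show ?thesis using leaf[of p] leaf[of q] center assms(2) by auto
  next
    case 3
    then show ?thesis by (rule has_fan_grow_base[OF _ assms(2-9)])
  qed
qed

end

lemma two_tree_ge_2: "two_tree en V E \<Longrightarrow> card V \<ge> 2"
proof (induction rule: two_tree.induct)
  case (attach V E e0 y z x e1 e2)
  then show ?case
    using two_tree_edges_on[OF attach.hyps(1)] by (simp add: edges_on_def)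
qed auto

lemma two_tree_card_2:
  assumes "two_tree en V E" "card V = 2"
  shows "\<exists>a b e. V = {a, b} \<and> E = {e} \<and> a \<noteq> b \<and> en e = {a, b}"
  using assms(1)
proof cases
  case (attach V' E' e0 y z x e1 e2)
  then show ?thesis
    using two_tree_ge_2[OF attach(3)] two_tree_edges_on[OF attach(3)] assms(2)
    by (simp add: edges_on_def)
qed auto

definition is_triangle where
  "is_triangle en V E y z q e e' e'' \<longleftrightarrow> V = {y, z, q} \<and> distinct [y, z, q] \<and> E = {e, e', e''} \<and>
    distinct [e, e', e''] \<and> en e = {y, z} \<and> en e' = {y, q} \<and> en e'' = {z, q}"

lemma is_triangle_flip: "is_triangle en V E y z q e e' e'' \<Longrightarrow> is_triangle en V E z y q e e'' e'"
  unfolding is_triangle_def by (simp; blast)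

lemma is_triangle_swap: "is_triangle en V E y z q e e' e'' \<Longrightarrow> is_triangle en V E y q z e' e e''"
  unfolding is_triangle_def by (simp; blast)

text \<open>The triangle read off the last attachment can be relabelled by flips and swaps so that
  any prescribed edge comes first.\<close>

lemma two_tree_card_3:
  assumes "two_tree en V E" "card V = 3" "e \<in> E" "en e = {y, z}"
  shows "\<exists>q e' e''. is_triangle en V E y z q e e' e''"
  using assms(1)
proof cases
  case (edge a b e)
  then show ?thesis using assms(2) by simp
next
  case (attach V' E' e0 b c x e1 e2)
  have "finite V'" using two_tree_edges_on[OF attach(3)] by (simp add: edges_on_def)
  then have "card V' = 2" using attach(1,6) assms(2) by simp
  then obtain b' c' where "V' = {b', c'}" "E' = {e0}" "b' \<noteq> c'" "en e0 = {b', c'}"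
    using two_tree_card_2[OF attach(3)] attach(4) by blast
  then have V': "V' = {b, c}" "E' = {e0}" "b \<noteq> c"
    using attach(5) by (auto simp: doubleton_eq_iff)
  have t: "is_triangle en V E b c x e0 e1 e2"
    unfolding is_triangle_def
  proof (intro conjI)
    show "V = {b, c, x}" "E = {e0, e1, e2}" using attach(1,2) V' by auto
    show "distinct [b, c, x]" using attach(6) V' by auto
    show "distinct [e0, e1, e2]" using attach(7-9) V' by auto
    show "en e0 = {b, c}" "en e1 = {b, x}" "en e2 = {c, x}"
      using attach(5,10,11) by (simp_all add: insert_commute)
  qed
  note t' = t is_triangle_swap[OF t] is_triangle_swap[OF is_triangle_flip[OF t]]
  have oriented: ?thesis if "is_triangle en V E b' c' x' e d d'" for b' c' x' d d'
  proof -
    have "y = b' \<and> z = c' \<or> y = c' \<and> z = b'"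
      using that assms(4) by (auto simp: is_triangle_def doubleton_eq_iff)
    then show ?thesis using that is_triangle_flip[OF that] by blast
  qed
  consider "e = e0" | "e = e1" | "e = e2" using assms(3) V'(2) attach(2) by blast
  then show ?thesis
    using t' oriented by cases blast+
qed

text \<open>The fan is carried along the construction. It first appears when a fourth vertex
  \<open>x\<close> is attached to a triangle: \<open>y\<close> becomes the centre and the triangle
  edge opposite \<open>y\<close> the base.\<close>

lemma two_tree_has_fan: "two_tree en V E \<Longrightarrow> card V \<ge> 4 \<Longrightarrow> has_fan en V E"
proof (induction rule: two_tree.induct)
  case (edge a b e)
  then show ?case by simp
next
  case (attach V E e0 y z x e1 e2)
  have fin: "finite V" using two_tree_edges_on[OF attach.hyps(1)] by (simp add: edges_on_def)
  show ?case
  proof (cases "card V \<ge> 4")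
    case True
    then obtain V0 E0 v p q d0 ep eq L f g r where
      fan: "fan en V0 E0 v p q d0 ep eq L f g r" and L: "L \<noteq> {}"
        "V = fan.VL V0 v L" "E = fan.EL E0 ep eq f g L"
      using attach.IH unfolding has_fan_def by blast
    interpret fan en V0 E0 v p q d0 ep eq L f g r by (rule fan)
    show ?thesis
      using has_fan_attach[of e0 y z x e1 e2] attach.hyps L by simp
  next
    case False
    then have "card V = 3" using attach.prems fin attach.hyps(4) by simp
    then obtain q e' e'' where q: "V = {y, z, q}" "distinct [y, z, q]" "E = {e0, e', e''}"
      "distinct [e0, e', e'']" "en e' = {y, q}" "en e'' = {z, q}"
      using two_tree_card_3[OF attach.hyps(1) _ attach.hyps(2,3)] unfolding is_triangle_def by blast
    have "two_tree en {z, q} {e''}" using q by (intro two_tree.edge) auto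
    \<comment> \<open>There are no leaves yet, so the maps for leaf edges and rims are given
      arbitrary values.\<close>
    then have fan: "fan en {z, q} {e''} y z q e'' e0 e' {} (\<lambda>_. e0) (\<lambda>_. e0) (\<lambda>_. z)"
      using q attach.hyps(3) by unfold_locales auto
    interpret fan en "{z, q}" "{e''}" y z q e'' e0 e' "{}" "\<lambda>_. e0" "\<lambda>_. e0" "\<lambda>_. z"
      by (rule fan)
    have "V = VL {}" "E = EL {}" using q by (auto simp: VL_def EL_def)
    then show ?thesis using has_fan_add_leaf[of x e1 e2 z] attach.hyps by simp
  qed
qed

section \<open>From flows modulo 3 to integer flows\<close>

definition net_flow :: "('e \<Rightarrow> 'v) \<Rightarrow> ('e \<Rightarrow> 'v) \<Rightarrow> 'e set \<Rightarrow> ('e \<Rightarrow> int) \<Rightarrow> 'v \<Rightarrow> int" where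
  "net_flow t h E f u = (\<Sum>e\<in>E. f e * arc (t e) (h e) u)"

text \<open>An edge of negative value is read against its direction, so each step carries a positive
  amount. The set \<open>A\<close> lets vertices already passed be discarded.\<close>

definition flow_steps :: "('e \<Rightarrow> 'v) \<Rightarrow> ('e \<Rightarrow> 'v) \<Rightarrow> 'e set \<Rightarrow> ('e \<Rightarrow> int) \<Rightarrow> 'v set \<Rightarrow> ('v \<times> 'v) set" where
  "flow_steps t h E f A = {(a, b). a \<in> A \<and> b \<in> A \<and>
     (\<exists>e\<in>E. t e = a \<and> h e = b \<and> f e > 0 \<or> t e = b \<and> h e = a \<and> f e < 0)}"

text \<open>Cutting a walk at its last visit to \<open>s\<close> leaves a tail that avoids
  \<open>s\<close>. This keeps the rerouting from using a changed edge again.\<close>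

lemma rtrancl_last_exit:
  assumes "(a, t) \<in> R\<^sup>*" "t \<noteq> s"
  defines "R' \<equiv> {(a, b) \<in> R. a \<noteq> s \<and> b \<noteq> s}"
  shows "(a, t) \<in> R'\<^sup>* \<or> (\<exists>s1. (s, s1) \<in> R \<and> (s1, t) \<in> R'\<^sup>*)"
  using assms(1)
proof (induction rule: converse_rtrancl_induct)
  case base
  then show ?case by simp
next
  case (step a b)
  have nots: "(s, t) \<notin> R'\<^sup>*"
    using assms(2) by (auto simp: R'_def elim: converse_rtranclE)
  from step.IH show ?case
  proof
    assume bt: "(b, t) \<in> R'\<^sup>*"
    with nots have "b \<noteq> s" by auto
    show ?thesis
    proof (cases "a = s")
      case True
      then show ?thesis using step.hyps(1) bt by blast
    next
      case False
      then have "(a, b) \<in> R'" using step.hyps(1) \<open>b \<noteq> s\<close> by (simp add: R'_def)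
      then show ?thesis using bt by (blast intro: converse_rtrancl_into_rtrancl)
    qed
  qed blast
qed

lemma net_flow_upd:
  assumes "finite E" "e \<in> E"
  shows "net_flow t h E (f(e := c)) u = net_flow t h E f u + (c - f e) * arc (t e) (h e) u"
proof -
  have "(\<Sum>e'\<in>E - {e}. (f(e := c)) e' * arc (t e') (h e') u) =
      (\<Sum>e'\<in>E - {e}. f e' * arc (t e') (h e') u)"
    by (rule sum.cong) auto
  then show ?thesis
    unfolding net_flow_def using assms
    by (simp add: sum.remove[of E e] algebra_simps)
qed

text \<open>Changing \<open>f e\<close> to \<open>f e - 3 sgn (f e)\<close> along a directed path moves three units of excess from
  its start to its end and stays within \<open>{1, -1, 2, -2}\<close>.\<close>

lemma reroute:
  assumes "finite A" "finite E" "\<forall>e\<in>E. f e \<in> {1, -1, 2, -2}" "(s, d) \<in> (flow_steps t h E f A)\<^sup>*"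
  shows "\<exists>f'. (\<forall>e\<in>E. f' e \<in> {1, -1, 2, -2}) \<and>
    (\<forall>u. net_flow t h E f' u = net_flow t h E f u - 3 * arc s d u)"
  using assms
proof (induction A arbitrary: f s rule: finite_psubset_induct)
  case (psubset A)
  show ?case
  proof (cases "s = d")
    case True
    then show ?thesis using psubset.prems by (intro exI[of _ f]) (simp add: arc_def)
  next
    case False
    let ?R = "flow_steps t h E f A"
    have sub: "{(a, b) \<in> ?R. a \<noteq> s \<and> b \<noteq> s} \<subseteq> flow_steps t h E f (A - {s})"
      by (auto simp: flow_steps_def)
    have "\<exists>s1. (s, s1) \<in> ?R \<and> (s1, d) \<in> {(a, b) \<in> ?R. a \<noteq> s \<and> b \<noteq> s}\<^sup>*"
      using rtrancl_last_exit[OF psubset.prems(3), of s] False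
      by (auto elim: converse_rtranclE)
    then obtain s1 where s1: "(s, s1) \<in> ?R" "(s1, d) \<in> (flow_steps t h E f (A - {s}))\<^sup>*"
      using rtrancl_mono[OF sub] by blast
    then obtain e where e: "e \<in> E" "s \<in> A" "t e = s \<and> h e = s1 \<and> f e > 0 \<or> t e = s1 \<and> h e = s \<and> f e < 0"
      by (auto simp: flow_steps_def)
    define f1 where "f1 = f(e := f e - 3 * sgn (f e))"
    have vals: "\<forall>e\<in>E. f1 e \<in> {1, -1, 2, -2}"
      using psubset.prems(2) e(1) by (auto simp: f1_def)
    have net: "net_flow t h E f1 u = net_flow t h E f u - 3 * arc s s1 u" for u
      unfolding f1_def net_flow_upd[OF psubset.prems(1) e(1)] using e(3) by (auto simp: arc_def)
    \<comment> \<open>The only changed edge has \<open>s\<close> as an end, so the steps that avoid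
      \<open>s\<close> persist.\<close>
    have "flow_steps t h E f (A - {s}) \<subseteq> flow_steps t h E f1 (A - {s})"
    proof
      fix x assume "x \<in> flow_steps t h E f (A - {s})"
      then obtain a b e' where x: "x = (a, b)" "a \<in> A - {s}" "b \<in> A - {s}" "e' \<in> E"
        "t e' = a \<and> h e' = b \<and> f e' > 0 \<or> t e' = b \<and> h e' = a \<and> f e' < 0"
        by (auto simp: flow_steps_def)
      then have "e' \<noteq> e" using e(3) by auto
      then have "f1 e' = f e'" by (simp add: f1_def)
      then show "x \<in> flow_steps t h E f1 (A - {s})"
        using x by (auto simp: flow_steps_def)
    qed
    then have "(s1, d) \<in> (flow_steps t h E f1 (A - {s}))\<^sup>*"
      using s1(2) rtrancl_mono by blast
    then obtain f' where f': "\<forall>e\<in>E. f' e \<in> {1, -1, 2, -2}"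
      "\<forall>u. net_flow t h E f' u = net_flow t h E f1 u - 3 * arc s1 d u"
      using psubset.IH[of "A - {s}" f1 s1] psubset.prems(1) vals e(2) by blast
    have "net_flow t h E f' u = net_flow t h E f u - 3 * arc s d u" for u
      using f'(2) net[of u] by (simp add: arc_def)
    then show ?thesis using f'(1) by blast
  qed
qed

text \<open>Edges inside \<open>S\<close> cancel, and only those crossing the boundary of
  \<open>S\<close> count.\<close>

lemma sum_net_flow:
  assumes "finite S"
  shows "sum (net_flow t h E f) S = (\<Sum>e\<in>E. f e * (of_bool (t e \<in> S) - of_bool (h e \<in> S)))"
proof -
  have one: "(\<Sum>u\<in>S. of_bool (u = a)) = (of_bool (a \<in> S) :: int)" for a
    using assms by (simp add: of_bool_def)
  have "sum (net_flow t h E f) S = (\<Sum>e\<in>E. \<Sum>u\<in>S. f e * arc (t e) (h e) u)"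
    unfolding net_flow_def by (rule sum.swap)
  also have "\<dots> = (\<Sum>e\<in>E. f e * (of_bool (t e \<in> S) - of_bool (h e \<in> S)))"
    by (rule sum.cong) (simp_all add: sum_distrib_left[symmetric] arc_def sum_subtractf one)
  finally show ?thesis .
qed

text \<open>No positive amount leaves the set reachable from \<open>s\<close>, so the total excess
  there is at most 0. The positive excess at \<open>s\<close> must then be balanced by a negative
  one.\<close>

lemma positive_reaches_negative:
  assumes "finite V" "\<forall>e\<in>E. t e \<in> V \<and> h e \<in> V" "s \<in> V" "net_flow t h E f s > 0"
  shows "\<exists>d\<in>V. net_flow t h E f d < 0 \<and> (s, d) \<in> (flow_steps t h E f V)\<^sup>*"
proof (rule ccontr)
  assume contr: "\<not> ?thesis"
  define S where "S = {d \<in> V. (s, d) \<in> (flow_steps t h E f V)\<^sup>*}"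
  have S: "finite S" "s \<in> S" using assms by (auto simp: S_def)
  have closed: "b \<in> S" if "a \<in> S" "(a, b) \<in> flow_steps t h E f V" for a b
    using that by (auto simp: S_def flow_steps_def intro: rtrancl_into_rtrancl)
  have "sum (net_flow t h E f) S \<le> 0"
    unfolding sum_net_flow[OF S(1)]
  proof (rule sum_nonpos)
    fix e assume e: "e \<in> E"
    have VV: "t e \<in> V" "h e \<in> V" using e assms(2) by auto
    have "h e \<in> S" if "f e > 0" "t e \<in> S"
      by (rule closed[OF that(2)]) (use e VV that in \<open>auto simp: flow_steps_def\<close>)
    moreover have "t e \<in> S" if "f e < 0" "h e \<in> S"
      by (rule closed[OF that(2)]) (use e VV that in \<open>auto simp: flow_steps_def\<close>)
    ultimately show "f e * (of_bool (t e \<in> S) - of_bool (h e \<in> S)) \<le> 0"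
      by (cases "f e" "0 :: int" rule: linorder_cases) (auto simp: of_bool_def)
  qed
  moreover have "0 < sum (net_flow t h E f) S"
  proof (rule sum_pos2[of S s "net_flow t h E f", OF S assms(4)])
    show "0 \<le> net_flow t h E f d" if "d \<in> S" for d
      using contr that by (auto simp: S_def not_less)
  qed
  ultimately show False by simp
qed

lemma sum_net_flow_zero:
  assumes "finite V" "\<forall>e\<in>E. t e \<in> V \<and> h e \<in> V"
  shows "sum (net_flow t h E f) V = 0"
  unfolding sum_net_flow[OF assms(1)] by (rule sum.neutral) (use assms(2) in auto)

text \<open>A nonzero excess divisible by 3 has absolute value at least 3, so moving three units
  from a positive to a negative vertex lowers the sum of absolute excesses. Without positive excess
  all are 0, because they sum to 0.\<close>

lemma integral_flow_of_mod3:
  assumes "finite V" "finite E" "\<forall>e\<in>E. t e \<in> V \<and> h e \<in> V"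
    "\<forall>e\<in>E. f e \<in> {1, -1, 2, -2}" "\<forall>u\<in>V. 3 dvd net_flow t h E f u"
  shows "\<exists>f'. (\<forall>e\<in>E. f' e \<in> {1, -1, 2, -2}) \<and> (\<forall>u\<in>V. net_flow t h E f' u = 0)"
  using assms(4,5)
proof (induction "nat (\<Sum>u\<in>V. \<bar>net_flow t h E f u\<bar>)" arbitrary: f rule: less_induct)
  case less
  show ?case
  proof (cases "\<exists>s\<in>V. net_flow t h E f s > 0")
    case True
    then obtain s where s: "s \<in> V" "net_flow t h E f s > 0" by blast
    then obtain d where d: "d \<in> V" "net_flow t h E f d < 0" "(s, d) \<in> (flow_steps t h E f V)\<^sup>*"
      using positive_reaches_negative[OF assms(1,3)] by blast
    obtain f' where f': "\<forall>e\<in>E. f' e \<in> {1, -1, 2, -2}"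
      "\<And>u. net_flow t h E f' u = net_flow t h E f u - 3 * arc s d u"
      using reroute[OF assms(1,2) less.prems(1) d(3)] by blast
    have ge: "net_flow t h E f s \<ge> 3" "net_flow t h E f d \<le> -3"
      using s(2) d(2) zdvd_imp_le[of 3 "net_flow t h E f s"] zdvd_imp_le[of 3 "- net_flow t h E f d"]
        less.prems(2) s(1) d(1) by fastforce+
    have "(\<Sum>u\<in>V. \<bar>net_flow t h E f' u\<bar>) < (\<Sum>u\<in>V. \<bar>net_flow t h E f u\<bar>)"
    proof (rule sum_strict_mono_ex1[OF assms(1)])
      show "\<forall>u\<in>V. \<bar>net_flow t h E f' u\<bar> \<le> \<bar>net_flow t h E f u\<bar>"
        using ge by (auto simp: f'(2) arc_def)
      have "s \<noteq> d" using ge by auto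
      then have "\<bar>net_flow t h E f' s\<bar> < \<bar>net_flow t h E f s\<bar>"
        using ge by (simp add: f'(2) arc_def)
      then show "\<exists>u\<in>V. \<bar>net_flow t h E f' u\<bar> < \<bar>net_flow t h E f u\<bar>"
        using s(1) by blast
    qed
    moreover have "0 \<le> (\<Sum>u\<in>V. \<bar>net_flow t h E f' u\<bar>)" by (rule sum_nonneg) simp
    ultimately have "nat (\<Sum>u\<in>V. \<bar>net_flow t h E f' u\<bar>) < nat (\<Sum>u\<in>V. \<bar>net_flow t h E f u\<bar>)"
      by linarith
    then show ?thesis
      by (rule less.hyps) (use f' less.prems(2) in \<open>auto simp: arc_def\<close>)
  next
    case False
    then have "\<forall>u\<in>V. 0 \<le> - net_flow t h E f u" by force
    moreover have "(\<Sum>u\<in>V. - net_flow t h E f u) = 0"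
      using sum_net_flow_zero[OF assms(1,3), of f] by (simp add: sum_negf)
    ultimately have "\<forall>u\<in>V. - net_flow t h E f u = 0"
      using sum_nonneg_eq_0_iff[OF assms(1), of "\<lambda>u. - net_flow t h E f u"] by simp
    then show ?thesis using less.prems(1) by (intro exI[of _ f]) simp
  qed
qed

section \<open>Flows in the graph as orientations modulo 3\<close>

lemma multigraph_edges_on: "multigraph G \<Longrightarrow> edges_on (ends G) (vertices G) (edges G)"
  unfolding multigraph_def edges_on_def card_2_iff by (metis insert_subset)

lemma net_flow_out_in:
  assumes "finite E" "\<forall>e\<in>E. t e \<noteq> h e"
  shows "net_flow t h E f u = (\<Sum>e\<in>{e \<in> E. t e = u}. f e) - (\<Sum>e\<in>{e \<in> E. h e = u}. f e)"
proof -
  have "net_flow t h E f u = (\<Sum>e\<in>E. (if t e = u then f e else 0) - (if h e = u then f e else 0))"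
    unfolding net_flow_def by (rule sum.cong) (auto simp: arc_def)
  then show ?thesis using assms(1) by (simp add: sum_subtractf sum.inter_filter)
qed

lemma nowhere_zero_3_flow_iff:
  assumes "multigraph G"
  shows "nowhere_zero_3_flow G D f \<longleftrightarrow> orientation G D \<and> (\<forall>e\<in>edges G. f e \<in> {1, -1, 2, -2}) \<and>
    (\<forall>u\<in>vertices G. net_flow (tail D) (head D) (edges G) f u = 0)"
proof -
  have fin: "finite (edges G)" using assms by (simp add: multigraph_def)
  have "net_flow (tail D) (head D) (edges G) f u = (\<Sum>e\<in>out_arcs D u. f e) - (\<Sum>e\<in>in_arcs D u. f e)"
    if "orientation G D" for u
  proof -
    have "tail D e \<noteq> head D e" if e: "e \<in> edges G" for e
    proof
      assume "tail D e = head D e"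
      then have "ends G e = {tail D e}"
        using \<open>orientation G D\<close> e unfolding orientation_def by (metis insert_absorb2)
      then show False using assms e by (auto simp: multigraph_def)
    qed
    then show ?thesis
      using net_flow_out_in[OF fin, of "tail D" "head D" f u] \<open>orientation G D\<close>
      by (simp add: orientation_def out_arcs_def in_arcs_def)
  qed
  then show ?thesis by (auto simp: nowhere_zero_3_flow_def)
qed

lemma net_flow_cong3:
  assumes "\<And>e. e \<in> E \<Longrightarrow> 3 dvd f e - g e"
  shows "3 dvd net_flow t h E f u - net_flow t h E g u"
proof -
  have "net_flow t h E f u - net_flow t h E g u = (\<Sum>e\<in>E. (f e - g e) * arc (t e) (h e) u)"
    by (simp add: net_flow_def sum_subtractf[symmetric] left_diff_distrib)
  also have "3 dvd \<dots>" by (rule dvd_sum) (use assms in auto)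
  finally show ?thesis .
qed

text \<open>A flow value is 1 or -1 modulo 3, and reversing the edges of residue -1 gives the
  orientation. Conversely, the constant value 1 on a balanced orientation is a flow modulo 3, which
  rerouting makes integral.\<close>

lemma has_nowhere_zero_3_flow_iff:
  assumes "multigraph G"
  shows "has_nowhere_zero_3_flow G \<longleftrightarrow> orientable (ends G) (edges G) (\<lambda>_. 0)"
proof
  note on = multigraph_edges_on[OF assms]
  have fin: "finite (vertices G)" "finite (edges G)" using on by (auto simp: edges_on_def)
  assume "has_nowhere_zero_3_flow G"
  then obtain D f where D: "orientation G D" and f: "\<forall>e\<in>edges G. f e \<in> {1, -1, 2, -2}"
    and net: "\<forall>u\<in>vertices G. net_flow (tail D) (head D) (edges G) f u = 0"
    by (auto simp: has_nowhere_zero_3_flow_def nowhere_zero_3_flow_iff[OF assms])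
  \<comment> \<open>The values congruent to 1 modulo 3; all other edges are reversed.\<close>
  define pos where "pos e \<longleftrightarrow> f e = 1 \<or> f e = -2" for e
  define t where "t e = (if pos e then tail D e else head D e)" for e
  define h where "h e = (if pos e then head D e else tail D e)" for e
  have en: "ends G e = {t e, h e}" if "e \<in> edges G" for e
    using that D by (auto simp: t_def h_def orientation_def)
  have "3 dvd 0 - (\<Sum>e\<in>edges G. arc (t e) (h e) u)" for u
  proof (cases "u \<in> vertices G")
    case True
    define g :: "_ \<Rightarrow> int" where "g e = (if pos e then 1 else -1)" for e
    have "(\<Sum>e\<in>edges G. arc (t e) (h e) u) = net_flow (tail D) (head D) (edges G) g u"
      unfolding net_flow_def by (rule sum.cong) (auto simp: t_def h_def g_def arc_def)
    moreover have "3 dvd net_flow (tail D) (head D) (edges G) f u - net_flow (tail D) (head D) (edges G) g u"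
      by (rule net_flow_cong3) (use f in \<open>auto simp: g_def pos_def\<close>)
    ultimately show ?thesis using net True by simp
  next
    case False
    have "arc (t e) (h e) u = 0" if "e \<in> edges G" for e
    proof -
      have "u \<notin> ends G e" using assms that False by (auto simp: multigraph_def)
      then show ?thesis using en[OF that] by (simp add: arc_def)
    qed
    then show ?thesis by simp
  qed
  then show "orientable (ends G) (edges G) (\<lambda>_. 0)"
    unfolding orientable_def using en by blast
next
  note on = multigraph_edges_on[OF assms]
  have fin: "finite (vertices G)" "finite (edges G)" using on by (auto simp: edges_on_def)
  assume "orientable (ends G) (edges G) (\<lambda>_. 0)"
  then obtain t h where en: "\<forall>e\<in>edges G. ends G e = {t e, h e}"
    and d: "\<And>u. 3 dvd 0 - (\<Sum>e\<in>edges G. arc (t e) (h e) u)"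
    unfolding orientable_def by blast
  have ends: "\<forall>e\<in>edges G. t e \<in> vertices G \<and> h e \<in> vertices G"
    using assms en by (auto simp: multigraph_def)
  have "3 dvd net_flow t h (edges G) (\<lambda>_. 1) u" for u
    using d[of u] by (simp add: net_flow_def)
  then obtain f where f: "\<forall>e\<in>edges G. f e \<in> {1, -1, 2, -2}"
    "\<forall>u\<in>vertices G. net_flow t h (edges G) f u = 0"
    using integral_flow_of_mod3[OF fin ends, of "\<lambda>_. 1"] by auto
  define D where "D = \<lparr>verts = vertices G, arcs = edges G, tail = t, head = h\<rparr>"
  have "orientation G D" using en by (simp add: orientation_def D_def)
  then have "nowhere_zero_3_flow G D f"
    unfolding nowhere_zero_3_flow_iff[OF assms] using f by (simp add: D_def)
  then show "has_nowhere_zero_3_flow G"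
    unfolding has_nowhere_zero_3_flow_def by blast
qed

section \<open>Bull-reductions\<close>

text \<open>Three distinct neighbours already need three edges, so at degree 3 none of them is
  doubled.\<close>

lemma degree_3_edges:
  assumes "multigraph G" "degree G u = 3" "neighbors G u = {x, y, z}" "distinct [x, y, z]"
  shows "\<exists>e1 e2 e3. {e \<in> edges G. u \<in> ends G e} = {e1, e2, e3} \<and> distinct [e1, e2, e3] \<and>
    ends G e1 = {u, x} \<and> ends G e2 = {u, y} \<and> ends G e3 = {u, z}"
proof -
  have "adjacent G u x" "adjacent G u y" "adjacent G u z"
    using assms(3) by (auto simp: neighbors_def)
  then obtain e1 e2 e3 where e: "{e1, e2, e3} \<subseteq> edges G" "ends G e1 = {u, x}" "ends G e2 = {u, y}"
    "ends G e3 = {u, z}"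
    unfolding adjacent_def by auto
  have d: "distinct [e1, e2, e3]"
    using assms(4) e by (auto simp: doubleton_eq_iff)
  have sub: "{e1, e2, e3} \<subseteq> {e \<in> edges G. u \<in> ends G e}" using e by auto
  have "finite {e \<in> edges G. u \<in> ends G e}" using assms(1) by (simp add: multigraph_def)
  then have "{e1, e2, e3} = {e \<in> edges G. u \<in> ends G e}"
    by (rule card_subset_eq[OF _ sub]) (use assms(2) d in \<open>simp add: degree_def\<close>)
  then show ?thesis using d e by blast
qed

text \<open>Modulo 3 a vertex of degree 3 is a source or a sink, so the two degree-3 vertices of a bull
  have opposite kinds and their other edges carry one unit between \<open>a\<close> and \<open>b\<close>.\<close>

lemma orientable_bull:
  assumes "finite R" "\<And>e. e \<in> R \<Longrightarrow> u \<notin> en e \<and> v \<notin> en e"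
    "distinct [e1, e2, e3, e4, e5]" "{e1, e2, e3, e4, e5} \<inter> R = {}"
    "en e1 = {u, v}" "en e2 = {u, w}" "en e3 = {u, a}" "en e4 = {v, w}" "en e5 = {v, b}"
    "u \<notin> {v, w, a, b}" "v \<notin> {w, a, b}"
  shows "orientable en (insert e1 (insert e2 (insert e3 (insert e4 (insert e5 R))))) (\<lambda>_. 0) \<longleftrightarrow>
    (\<exists>s\<in>{1, -1}. orientable en R (\<lambda>x. - s * arc a b x))" (is "?L \<longleftrightarrow> ?R")
proof -
  define \<beta> where "\<beta> s1 s2 s3 s4 s5 x =
    0 - s1 * arc u v x - s2 * arc u w x - s3 * arc u a x - s4 * arc v w x - s5 * arc v b x"
    for s1 s2 s3 s4 s5 and x
  have fresh: "finite (insert e2 (insert e3 (insert e4 (insert e5 R))))"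
    "e1 \<notin> insert e2 (insert e3 (insert e4 (insert e5 R)))"
    "finite (insert e3 (insert e4 (insert e5 R)))" "e2 \<notin> insert e3 (insert e4 (insert e5 R))"
    "finite (insert e4 (insert e5 R))" "e3 \<notin> insert e4 (insert e5 R)"
    "finite (insert e5 R)" "e4 \<notin> insert e5 R" "e5 \<notin> R"
    using assms(1,3,4) by auto
  have "?L \<longleftrightarrow> (\<exists>s1\<in>{1, -1}. \<exists>s2\<in>{1, -1}. \<exists>s3\<in>{1, -1}. \<exists>s4\<in>{1, -1}. \<exists>s5\<in>{1, -1}.
      orientable en R (\<beta> s1 s2 s3 s4 s5))"
    unfolding \<beta>_def orientable_insert[of "insert e2 (insert e3 (insert e4 (insert e5 R)))" e1 en u v, OF fresh(1,2) assms(5)]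
      orientable_insert[of "insert e3 (insert e4 (insert e5 R))" e2 en u w, OF fresh(3,4) assms(6)]
      orientable_insert[of "insert e4 (insert e5 R)" e3 en u a, OF fresh(5,6) assms(7)]
      orientable_insert[of "insert e5 R" e4 en v w, OF fresh(7,8) assms(8)]
      orientable_insert[of R e5 en v b, OF assms(1) fresh(9) assms(9)] ..
  also have "\<dots> \<longleftrightarrow> ?R"
  proof
    assume "\<exists>s1\<in>{1, -1}. \<exists>s2\<in>{1, -1}. \<exists>s3\<in>{1, -1}. \<exists>s4\<in>{1, -1}. \<exists>s5\<in>{1, -1}.
      orientable en R (\<beta> s1 s2 s3 s4 s5)"
    then obtain s1 s2 s3 s4 s5 :: int where s: "s1 \<in> {1, -1}" "s2 \<in> {1, -1}" "s3 \<in> {1, -1}"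
      "s4 \<in> {1, -1}" "s5 \<in> {1, -1}" and or: "orientable en R (\<beta> s1 s2 s3 s4 s5)"
      by blast
    \<comment> \<open>No edge of \<open>R\<close> meets \<open>u\<close> or \<open>v\<close>, so
      nothing may be left there. Three signs with sum divisible by 3 are equal, which expresses all
      five signs by \<open>s1\<close>.\<close>
    have "3 dvd \<beta> s1 s2 s3 s4 s5 u" "3 dvd \<beta> s1 s2 s3 s4 s5 v"
      using orientable_zero_off_support[OF or] assms(2) by blast+
    moreover have "\<beta> s1 s2 s3 s4 s5 u = - s1 - s2 - s3" "\<beta> s1 s2 s3 s4 s5 v = s1 - s4 - s5"
      using assms(10,11) by (auto simp: \<beta>_def arc_def)
    ultimately have eq: "s2 = s1" "s3 = s1" "s4 = - s1" "s5 = - s1"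
      using s by auto
    have "\<beta> s1 s2 s3 s4 s5 x - - (- s1) * arc a b x = 3 * (- s1 * arc u v x)" for x
      unfolding eq \<beta>_def by (simp add: arc_def algebra_simps)
    then have "orientable en R (\<lambda>x. - (- s1) * arc a b x)"
      by (intro orientable_cong[OF or]) (metis dvd_triv_left)
    then show ?R using s(1) by (intro bexI[of _ "- s1"]) auto
  next
    assume ?R
    then obtain s :: int where s: "s \<in> {1, -1}" and or: "orientable en R (\<lambda>x. - s * arc a b x)"
      by blast
    have "- s * arc a b x - \<beta> (- s) (- s) (- s) s s x = 3 * (- s * arc u v x)" for x
      unfolding \<beta>_def by (simp add: arc_def algebra_simps)
    then have "orientable en R (\<beta> (- s) (- s) (- s) s s)"
      by (intro orientable_cong[OF or]) (metis dvd_triv_left)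
    then show "\<exists>s1\<in>{1, -1}. \<exists>s2\<in>{1, -1}. \<exists>s3\<in>{1, -1}. \<exists>s4\<in>{1, -1}. \<exists>s5\<in>{1, -1}.
      orientable en R (\<beta> s1 s2 s3 s4 s5)"
      using s by (intro bexI[of _ s] bexI[of _ "- s"]) auto
  qed
  finally show ?thesis .
qed

lemma bull_reduction_props:
  assumes "bull_reduction G H"
  shows "multigraph H \<and> card (vertices H) < card (vertices G) \<and>
    (has_nowhere_zero_3_flow G \<longleftrightarrow> has_nowhere_zero_3_flow H)"
proof -
  from assms obtain u v w a b where G: "multigraph G" and uv: "u \<in> vertices G" "v \<in> vertices G"
    and deg: "degree G u = 3" "degree G v = 3"
    and nu: "neighbors G u = {v, w, a}" "a \<noteq> v" "a \<noteq> w"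
    and nv: "neighbors G v = {u, w, b}" "b \<noteq> u" "b \<noteq> w"
    and H: "if a = b then H = delete_vertices G {u, v}
      else (\<exists>e. e \<notin> edges (delete_vertices G {u, v}) \<and> H = add_edge (delete_vertices G {u, v}) e a b)"
    unfolding bull_reduction_def by blast
  have adj: "x \<noteq> y \<and> y \<in> vertices G" if "y \<in> neighbors G x" for x y
    using that G by (auto simp: neighbors_def adjacent_def multigraph_def)
  have neq: "u \<notin> {v, w, a, b}" "v \<notin> {w, a, b}"
    using adj[of _ u] adj[of _ v] nu nv by auto
  have ab: "a \<in> vertices G - {u, v}" "b \<in> vertices G - {u, v}"
    using adj[of _ u] adj[of _ v] nu nv neq by auto
  have du: "distinct [v, w, a]" and dv: "distinct [u, w, b]" using nu nv neq by auto
  obtain e1 e2 e3 where eu: "{e \<in> edges G. u \<in> ends G e} = {e1, e2, e3}" "distinct [e1, e2, e3]"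
    "ends G e1 = {u, v}" "ends G e2 = {u, w}" "ends G e3 = {u, a}"
    using degree_3_edges[OF G deg(1) nu(1) du] by blast
  obtain d1 e4 e5 where ev: "{e \<in> edges G. v \<in> ends G e} = {d1, e4, e5}" "distinct [d1, e4, e5]"
    "ends G d1 = {v, u}" "ends G e4 = {v, w}" "ends G e5 = {v, b}"
    using degree_3_edges[OF G deg(2) nv(1) dv] by blast
  \<comment> \<open>The edge between \<open>u\<close> and \<open>v\<close> was obtained once from
    each end; both names denote the same edge.\<close>
  have "e1 \<in> {d1, e4, e5}" unfolding ev(1)[symmetric] using eu by auto
  then have "e1 = d1" using eu(3) ev(4,5) neq by (auto simp: doubleton_eq_iff)
  note ev = ev[folded this]
  define R where "R = edges (delete_vertices G {u, v})"
  have R: "R = {e \<in> edges G. ends G e \<inter> {u, v} = {}}" by (simp add: R_def delete_vertices_def)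
  have fin: "finite R" using G by (simp add: R multigraph_def)
  have E: "edges G = insert e1 (insert e2 (insert e3 (insert e4 (insert e5 R))))"
    using eu(1) ev(1) unfolding R by blast
  have "u \<notin> ends G e4" "u \<notin> ends G e5" using ev(4,5) neq by auto
  then have "distinct [e1, e2, e3, e4, e5]" using eu(2-5) ev(2) by auto
  moreover have "{e1, e2, e3, e4, e5} \<inter> R = {}" using eu(3-5) ev(4,5) by (auto simp: R)
  ultimately have or: "orientable (ends G) (edges G) (\<lambda>_. 0) \<longleftrightarrow>
      (\<exists>s\<in>{1, -1}. orientable (ends G) R (\<lambda>x. - s * arc a b x))"
    unfolding E by (intro orientable_bull[OF fin]) (use eu ev neq in \<open>auto simp: R\<close>)
  have VH: "vertices H = vertices G - {u, v}"
    using H by (auto simp: delete_vertices_def add_edge_def split: if_splits)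
  have finV: "finite (vertices G)" using G by (simp add: multigraph_def)
  have card: "card (vertices H) < card (vertices G)"
    unfolding VH by (rule psubset_card_mono[OF finV]) (use uv in auto)
  have RG: "ends G e \<subseteq> vertices G - {u, v}" "card (ends G e) = 2" if "e \<in> R" for e
    using that G by (auto simp: R multigraph_def)
  have "multigraph H \<and> (orientable (ends G) (edges G) (\<lambda>_. 0) \<longleftrightarrow> orientable (ends H) (edges H) (\<lambda>_. 0))"
  proof (cases "a = b")
    case True
    then have EH: "edges H = R" "ends H = ends G"
      using H by (auto simp: R_def delete_vertices_def)
    have "multigraph H"
      using RG fin finV by (simp add: multigraph_def EH VH)
    \<comment> \<open>The new edge would be a loop and contributes nothing, in accordance with its
      deletion.\<close>
    moreover have "arc a b = (\<lambda>_. 0)" using True by (simp add: arc_def fun_eq_iff)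
    ultimately show ?thesis unfolding or EH by auto
  next
    case False
    then obtain e where e: "e \<notin> R" and "H = add_edge (delete_vertices G {u, v}) e a b"
      using H by (auto simp: R_def)
    then have EH: "edges H = insert e R" "ends H = (ends G)(e := {a, b})"
      by (auto simp: R_def delete_vertices_def add_edge_def)
    have "multigraph H"
      unfolding multigraph_def EH VH
      using RG fin finV ab False by auto
    moreover have "orientable (ends H) (insert e R) (\<lambda>_. 0) \<longleftrightarrow>
        (\<exists>s\<in>{1, -1}. orientable (ends H) R (\<lambda>x. 0 - s * arc a b x))"
      by (rule orientable_insert[OF fin e]) (simp add: EH)
    moreover have "orientable (ends H) R \<beta> \<longleftrightarrow> orientable (ends G) R \<beta>" for \<beta>
      by (rule orientable_ends_cong) (use e in \<open>auto simp: EH\<close>)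
    ultimately show ?thesis unfolding or EH(1) by simp
  qed
  then show ?thesis
    using card has_nowhere_zero_3_flow_iff[OF G] has_nowhere_zero_3_flow_iff[of H] by blast
qed

section \<open>Graphs formed from the complete graph on four vertices have no flow\<close>

text \<open>A sum of three signs is divisible by 3 only if the signs agree.\<close>

lemma degree_3_source_or_sink:
  assumes "finite E" "\<forall>e\<in>E. en e = {t e, h e} \<and> t e \<noteq> h e" "3 dvd (\<Sum>e\<in>E. arc (t e) (h e) u)"
    "{e \<in> E. u \<in> en e} = {e1, e2, e3}" "distinct [e1, e2, e3]"
  shows "t e1 = u \<longleftrightarrow> t e2 = u"
proof -
  have e: "e \<in> E" "t e = u \<or> h e = u" "t e \<noteq> h e" if "e \<in> {e1, e2, e3}" for e
    using that assms(2) unfolding assms(4)[symmetric] by auto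
  have "(\<Sum>e\<in>E. arc (t e) (h e) u) = (\<Sum>e\<in>{e1, e2, e3}. arc (t e) (h e) u)"
    by (rule sum.mono_neutral_right[OF assms(1)])
      (use assms(2) in \<open>auto simp: assms(4)[symmetric] arc_def\<close>)
  then have "3 dvd arc (t e1) (h e1) u + arc (t e2) (h e2) u + arc (t e3) (h e3) u"
    using assms(3,5) by (simp add: add.assoc)
  then show ?thesis
    using e(2,3)[of e1] e(2,3)[of e2] e(2,3)[of e3] by (auto simp: arc_def)
qed

text \<open>Each vertex would be a source or a sink. Two of any three vertices are then of the same
  kind, and the edge joining them cannot be directed.\<close>

lemma is_K4_no_flow:
  assumes "is_K4 G"
  shows "\<not> has_nowhere_zero_3_flow G"
proof
  have G: "multigraph G" and V: "card (vertices G) = 4"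
    and K: "\<And>x y. x \<in> vertices G \<Longrightarrow> y \<in> vertices G \<Longrightarrow> x \<noteq> y \<Longrightarrow> \<exists>!e. e \<in> edges G \<and> ends G e = {x, y}"
    using assms by (auto simp: is_K4_def)
  have fin: "finite (edges G)" using G by (simp add: multigraph_def)
  assume "has_nowhere_zero_3_flow G"
  then obtain t h where th: "\<forall>e\<in>edges G. ends G e = {t e, h e}"
    and d: "\<And>u. 3 dvd 0 - (\<Sum>e\<in>edges G. arc (t e) (h e) u)"
    unfolding has_nowhere_zero_3_flow_iff[OF G] orientable_def by blast
  have loop: "t e \<noteq> h e" if "e \<in> edges G" for e
    using that th G by (auto simp: multigraph_def)
  define \<epsilon> where "\<epsilon> x y = (THE e. e \<in> edges G \<and> ends G e = {x, y})" for x y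
  have \<epsilon>: "\<epsilon> x y \<in> edges G" "ends G (\<epsilon> x y) = {x, y}"
    if "x \<in> vertices G" "y \<in> vertices G" "x \<noteq> y" for x y
    using theI'[OF K[OF that]] unfolding \<epsilon>_def by auto
  have \<epsilon>_eq: "e = \<epsilon> x y" if "x \<in> vertices G" "y \<in> vertices G" "x \<noteq> y" "e \<in> edges G" "ends G e = {x, y}" for x y e
    using K[OF that(1-3)] \<epsilon>[OF that(1-3)] that(4,5) by blast
  \<comment> \<open>The edge between \<open>x\<close> and \<open>y\<close> is directed away from
    \<open>x\<close>.\<close>
  define P where "P x y \<longleftrightarrow> t (\<epsilon> x y) = x" for x y
  have P_rev: "P y x \<longleftrightarrow> \<not> P x y" if "x \<in> vertices G" "y \<in> vertices G" "x \<noteq> y" for x y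
  proof -
    have "\<epsilon> y x = \<epsilon> x y"
      by (rule \<epsilon>_eq[OF that]) (use \<epsilon>[of y x] that in auto)
    moreover have "{t (\<epsilon> x y), h (\<epsilon> x y)} = {x, y}" "t (\<epsilon> x y) \<noteq> h (\<epsilon> x y)"
      using th loop \<epsilon>[OF that] by auto
    ultimately show ?thesis using that(3) by (auto simp: P_def doubleton_eq_iff)
  qed
  have P_same: "P x y \<longleftrightarrow> P x z" if xyz: "vertices G = {x, y, z, w}" "distinct [x, y, z, w]" for x y z w
  proof -
    have in_V: "x \<in> vertices G" "y \<in> vertices G" "z \<in> vertices G" "w \<in> vertices G"
      using xyz by auto
    have "{e \<in> edges G. x \<in> ends G e} = {\<epsilon> x y, \<epsilon> x z, \<epsilon> x w}"
    proof (intro equalityI subsetI)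
      fix e assume e: "e \<in> {e \<in> edges G. x \<in> ends G e}"
      then obtain y' z' where "y' \<in> vertices G" "z' \<in> vertices G" "ends G e = {y', z'}" "y' \<noteq> z'"
        using edges_onE[OF multigraph_edges_on[OF G]] by blast
      then obtain c where "ends G e = {x, c}" "c \<in> vertices G" "c \<noteq> x"
        using e by (cases "x = y'") (auto simp: insert_commute)
      then show "e \<in> {\<epsilon> x y, \<epsilon> x z, \<epsilon> x w}"
        using \<epsilon>_eq[of x c e] e in_V xyz by auto
    next
      fix e assume "e \<in> {\<epsilon> x y, \<epsilon> x z, \<epsilon> x w}"
      then show "e \<in> {e \<in> edges G. x \<in> ends G e}"
        using \<epsilon>[of x y] \<epsilon>[of x z] \<epsilon>[of x w] in_V xyz(2) by auto
    qed
    moreover have "distinct [\<epsilon> x y, \<epsilon> x z, \<epsilon> x w]"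
      using \<epsilon>(2)[of x y] \<epsilon>(2)[of x z] \<epsilon>(2)[of x w] in_V xyz(2) by (auto simp: doubleton_eq_iff)
    ultimately show ?thesis
      unfolding P_def
      by (intro degree_3_source_or_sink[OF fin _ _ , of "ends G" t h x]) (use th loop d[of x] in auto)
  qed
  obtain a b c d where abcd: "vertices G = {a, b, c, d}" "distinct [a, b, c, d]"
  proof -
    obtain a A where "vertices G = insert a A" "a \<notin> A" "card A = 3"
      using V card_Suc_eq[of "vertices G" 3] by auto
    moreover then obtain b c d where "A = {b, c, d}" "b \<noteq> c" "b \<noteq> d" "c \<noteq> d"
      using card_3_iff by metis
    ultimately show ?thesis using that[of a b c d] by auto
  qed
  have "P a b \<longleftrightarrow> P a c" "P b a \<longleftrightarrow> P b c" "P c a \<longleftrightarrow> P c b"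
    by (rule P_same[of _ _ _ d]; use abcd in auto)+
  moreover have "P b a \<longleftrightarrow> \<not> P a b" "P c a \<longleftrightarrow> \<not> P a c" "P c b \<longleftrightarrow> \<not> P b c"
    by (rule P_rev; use abcd in auto)+
  ultimately show False by blast
qed

lemma formed_from_K4_no_flow: "formed_from_K4 G \<Longrightarrow> \<not> has_nowhere_zero_3_flow G"
  by (induction rule: formed_from_K4.induct) (use is_K4_no_flow bull_reduction_props in blast)+

section \<open>Reducing graphs without a flow\<close>

text \<open>Without a split edge the zero boundary would be realised, and two split edges would give
  connectivity modulo 3; either yields the excluded orientation.\<close>

lemma unique_split:
  assumes "edges_on en V E'" "E \<subseteq> E'"
    and E: "\<And>\<beta>. zero_sum V \<beta> \<Longrightarrow> 3 dvd (\<Sum>u\<in>V. \<phi> u * \<beta> u) \<Longrightarrow> orientable en E \<beta>"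
    and no: "\<not> orientable en E' (\<lambda>_. 0)"
  shows "\<exists>!e. e \<in> E' - E \<and> splits en \<phi> e"
proof -
  have zs: "zero_sum V (\<lambda>_. 0)" by (simp add: zero_sum_def)
  have "\<exists>e\<in>E' - E. splits en \<phi> e"
    using orientable_no_split[OF assms(1,2) E _ zs] no by auto
  moreover have "e = e'" if "e \<in> E' - E" "splits en \<phi> e" "e' \<in> E' - E" "splits en \<phi> e'" for e e'
  proof (rule ccontr)
    assume "e \<noteq> e'"
    then have "Z3_connected en V E'"
      using Z3_connected_two_splits[OF assms(1,2) E that(1,3) _ that(2,4)] by blast
    then show False using no Z3_connected_zero by blast
  qed
  ultimately show ?thesis by blast
qed

section \<open>Two-trees and spanning triangle-trees\<close>

lemma two_tree_ends_cong:
  assumes "two_tree en V E" "\<And>e. e \<in> E \<Longrightarrow> en e = en' e"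
  shows "two_tree en' V E"
  using assms
proof (induction rule: two_tree.induct)
  case (edge a b e)
  then show ?case by (intro two_tree.edge) auto
next
  case (attach V E e0 y z x e1 e2)
  show ?case
    by (rule two_tree.attach[of en' V E e0 y z x e1 e2]) (use attach in auto)
qed

lemma two_tree_has_edge: "two_tree en V E \<Longrightarrow> \<exists>e\<in>E. \<exists>y z. en e = {y, z}"
  by (erule two_tree.cases) blast+

lemma triangle_tree_two_tree:
  "triangle_tree T \<Longrightarrow> two_tree (ends T) (vertices T) (edges T) \<and> card (vertices T) \<ge> 3"
proof (induction rule: triangle_tree.induct)
  case (triangle x1 x2 x3 e1 e2 e3 T)
  have "two_tree (ends T) {x1, x2} {e1}"
    using triangle by (intro two_tree.edge) auto
  then have "two_tree (ends T) (insert x3 {x1, x2}) (insert e3 (insert e2 {e1}))"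
    by (rule two_tree.attach[of _ _ _ e1 x1 x2]) (use triangle in auto)
  moreover have "insert x3 {x1, x2} = vertices T" "insert e3 (insert e2 {e1}) = edges T"
    using triangle by auto
  ultimately show ?case using triangle by simp
next
  case (add_vertex T y z x e1 e2)
  let ?en = "(ends T)(e1 := {x, y}, e2 := {x, z})"
  obtain e0 where e0: "e0 \<in> edges T" "ends T e0 = {y, z}"
    using add_vertex.hyps by (auto simp: adjacent_def)
  have tt: "two_tree (ends T) (vertices T) (edges T)" using add_vertex.IH by simp
  then have "two_tree ?en (vertices T) (edges T)"
    by (rule two_tree_ends_cong) (use add_vertex.hyps in auto)
  then have "two_tree ?en (insert x (vertices T)) (insert e1 (insert e2 (edges T)))"
    by (rule two_tree.attach[of _ _ _ e0 y z]) (use add_vertex.hyps e0 in auto)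
  moreover have "finite (vertices T)"
    using two_tree_edges_on[OF tt] by (simp add: edges_on_def)
  ultimately show ?case
    using add_vertex.hyps(3) add_vertex.IH by (simp add: fun_upd_def)
qed

text \<open>A two-tree keeps one incidence map, while \<open>triangle_tree\<close> updates it at
  each step; the updates change nothing because \<open>en\<close> already has the required
  values.\<close>

lemma two_tree_triangle_tree:
  "two_tree en V E \<Longrightarrow> card V \<ge> 3 \<Longrightarrow> triangle_tree \<lparr>vertices = V, edges = E, ends = en\<rparr>"
proof (induction rule: two_tree.induct)
  case (edge a b e)
  then show ?case by simp
next
  case (attach V E e0 y z x e1 e2)
  have fin: "finite V" using two_tree_edges_on[OF attach.hyps(1)] by (simp add: edges_on_def)
  show ?case
  proof (cases "card V \<ge> 3")
    case True
    let ?T = "\<lparr>vertices = V, edges = E, ends = en\<rparr>"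
    have "en(e1 := {x, y}, e2 := {x, z}) = en"
      using attach.hyps by (simp add: fun_upd_idem)
    moreover have "triangle_tree (?T\<lparr>vertices := insert x (vertices ?T),
        edges := insert e1 (insert e2 (edges ?T)),
        ends := (ends ?T)(e1 := {x, y}, e2 := {x, z})\<rparr>)"
      by (rule triangle_tree.add_vertex)
        (use attach True in \<open>auto simp: adjacent_def\<close>)
    ultimately show ?thesis by simp
  next
    case False
    then have "card (insert x V) = 3" using attach.prems attach.hyps(4) fin by simp
    moreover have "two_tree en (insert x V) (insert e1 (insert e2 E))"
      by (rule two_tree.attach[OF attach.hyps])
    ultimately obtain q e' e'' where
      t: "is_triangle en (insert x V) (insert e1 (insert e2 E)) x y q e1 e' e''"
      using two_tree_card_3[of en _ _ e1 x y] attach.hyps(8) by blast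
    show ?thesis
      by (rule triangle_tree.triangle[of x y q e1 e'' e'])
        (use t in \<open>auto simp: is_triangle_def\<close>)
  qed
qed

text \<open>The map \<open>en\<close> is kept apart from \<open>ends H\<close>, because a
  bull-reduction may redefine the ends of one edge name outside the tree.\<close>

lemma has_spanning_triangle_treeI:
  assumes "two_tree en (vertices H) E" "card (vertices H) \<ge> 3" "E \<subseteq> edges H"
    "\<And>e. e \<in> E \<Longrightarrow> ends H e = en e"
  shows "has_spanning_triangle_tree H"
  using two_tree_triangle_tree[OF assms(1,2)] assms(3,4)
  unfolding has_spanning_triangle_tree_def spanning_triangle_tree_def is_subgraph_def
  by (intro exI[of _ "\<lparr>vertices = vertices H, edges = E, ends = en\<rparr>"]) auto

lemma has_spanning_triangle_treeE:
  assumes "has_spanning_triangle_tree G"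
  obtains E where "two_tree (ends G) (vertices G) E" "E \<subseteq> edges G" "card (vertices G) \<ge> 3"
proof -
  obtain T where "triangle_tree T" "is_subgraph T G" "vertices T = vertices G"
    using assms by (auto simp: has_spanning_triangle_tree_def spanning_triangle_tree_def)
  then have "two_tree (ends G) (vertices G) (edges T)" "edges T \<subseteq> edges G" "card (vertices G) \<ge> 3"
    using triangle_tree_two_tree[of T] two_tree_ends_cong[of "ends T" _ "edges T" "ends G"]
    by (auto simp: is_subgraph_def)
  then show ?thesis by (rule that)
qed

lemma neighbors_of_edges:
  assumes "{e \<in> edges G. u \<in> ends G e} = {e1, e2, e3}"
    "ends G e1 = {u, x}" "ends G e2 = {u, y}" "ends G e3 = {u, z}"
  shows "neighbors G u = {x, y, z}"
proof
  show "neighbors G u \<subseteq> {x, y, z}"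
  proof
    fix w assume "w \<in> neighbors G u"
    then obtain e where e: "e \<in> edges G" "ends G e = {u, w}"
      by (auto simp: neighbors_def adjacent_def)
    then have "e \<in> {e1, e2, e3}" unfolding assms(1)[symmetric] by simp
    then show "w \<in> {x, y, z}" using e assms by (auto simp: doubleton_eq_iff)
  qed
  have "{e1, e2, e3} \<subseteq> edges G" unfolding assms(1)[symmetric] by auto
  then show "{x, y, z} \<subseteq> neighbors G u"
    using assms(2-4) by (auto simp: neighbors_def adjacent_def)
qed

text \<open>The six pairs of ends differ, so \<open>ends G\<close> is injective on the edges, which
  gives uniqueness.\<close>

lemma is_K4I:
  assumes "multigraph G" "vertices G = {a, b, c, d}" "distinct [a, b, c, d]"
    "edges G = {e1, e2, e3, e4, e5, e6}" "ends G e1 = {a, b}" "ends G e2 = {a, c}" "ends G e3 = {a, d}"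
    "ends G e4 = {b, c}" "ends G e5 = {b, d}" "ends G e6 = {c, d}"
  shows "is_K4 G"
proof -
  have d: "distinct [{a, b}, {a, c}, {a, d}, {b, c}, {b, d}, {c, d}]"
    using assms(3) by (simp add: doubleton_eq_iff)
  have "distinct (map (ends G) [e1, e2, e3, e4, e5, e6])"
    using d by (simp only: list.map assms(5-10))
  then have inj: "inj_on (ends G) (edges G)"
    unfolding assms(4) by (simp only: distinct_map list.set)
  have img: "ends G ` edges G = {{a, b}, {a, c}, {a, d}, {b, c}, {b, d}, {c, d}}"
    unfolding assms(4) by (simp only: image_insert image_empty assms(5-10))
  have "\<exists>!e. e \<in> edges G \<and> ends G e = {x, y}" if "x \<in> vertices G" "y \<in> vertices G" "x \<noteq> y" for x y
  proof -
    have "{x, y} \<in> ends G ` edges G"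
      using that unfolding img assms(2)
      by (elim insertE emptyE; hypsubst?; simp add: insert_commute)
    then show ?thesis using inj by (auto simp: inj_on_def)
  qed
  moreover have "card (vertices G) = 4" using assms(2,3) by simp
  ultimately show ?thesis
    unfolding is_K4_def using assms(1) by blast
qed

lemma bull_reductionI:
  assumes "multigraph G" "u \<in> vertices G" "v \<in> vertices G" "adjacent G u v"
    "degree G u = 3" "degree G v = 3" "neighbors G u = {v, w, a}" "a \<noteq> v" "a \<noteq> w"
    "neighbors G v = {u, w, b}" "b \<noteq> u" "b \<noteq> w"
    "if a = b then H = delete_vertices G {u, v}
      else \<exists>e. e \<notin> edges (delete_vertices G {u, v}) \<and> H = add_edge (delete_vertices G {u, v}) e a b"
  shows "bull_reduction G H"
  using assms unfolding bull_reduction_def by blast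

section \<open>Edges and colours at the leaves and the centre\<close>

context fan
begin

lemma edges_at_leaf:
  assumes "x \<in> L"
  shows "{e \<in> EL L. x \<in> en e} = {f x, g x}"
proof -
  have L: "L = insert x (L - {x})" using assms by auto
  have "x \<notin> VL (L - {x})" by (rule leaf_fresh) (use assms in auto)
  moreover have "edges_on en (VL (L - {x})) (EL (L - {x}))"
    by (intro two_tree_edges_on two_tree_sub) auto
  ultimately have "x \<notin> en e" if "e \<in> EL (L - {x})" for e
    using that by (auto elim!: edges_onE)
  then show ?thesis
    using ends_f[OF assms] ends_g[OF assms] L EL_insert[of x "L - {x}"] by auto
qed

lemma edges_at_center:
  assumes "L = {x}"
  shows "{e \<in> EL L. v \<in> en e} = {f x, ep, eq}"
proof -
  have "v \<notin> en e" if "e \<in> E0" for e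
    using that center(1) two_tree_edges_on[OF base(1)] by (auto elim!: edges_onE)
  moreover have "v \<notin> en (g x)"
    using ends_g[of x] rim[of x] pq center(1) leaves_new assms by auto
  ultimately show ?thesis
    using assms ends_f[of x] center by (auto simp: EL_def)
qed

text \<open>A leaf differs in colour from both of its tree neighbours.\<close>

lemma unsplit_leaf_edge:
  assumes "proper3 en (EL L) \<kappa>" "x \<in> L" "3 dvd \<kappa> x - \<kappa> c"
  shows "c \<noteq> v" "c \<noteq> r x"
proof -
  have "f x \<in> EL L" "g x \<in> EL L" using assms(2) by (auto simp: EL_def)
  then have "\<not> 3 dvd \<kappa> x - \<kappa> v" "\<not> 3 dvd \<kappa> x - \<kappa> (r x)"
    using proper3D[OF assms(1)] ends_f[OF assms(2)] ends_g[OF assms(2)] by blast+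
  then show "c \<noteq> v" "c \<noteq> r x" using assms(3) by auto
qed

text \<open>The vertices \<open>p\<close>, \<open>q\<close> and \<open>v\<close> use all three
  colours, so a leaf at \<open>p\<close> has the colour of \<open>q\<close> and a leaf at
  \<open>q\<close> that of \<open>p\<close>. The colour thus determines the rim.\<close>

lemma unsplit_leaves_same_rim:
  assumes "proper3 en (EL L) \<kappa>" "x \<in> L" "y \<in> L" "3 dvd \<kappa> x - \<kappa> y"
  shows "r x = r y"
proof -
  have "e0 \<in> EL L" "ep \<in> EL L" "eq \<in> EL L" "f x \<in> EL L" "g x \<in> EL L" "g y \<in> EL L"
    using assms(2,3) base(2) by (auto simp: EL_def)
  note proper = this[THEN proper3D[OF assms(1)]]
  have k: "\<not> 3 dvd \<kappa> p - \<kappa> q" "\<not> 3 dvd \<kappa> v - \<kappa> p" "\<not> 3 dvd \<kappa> v - \<kappa> q"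
    using proper(1-3) base(3) center(5,6) by blast+
  have kx: "\<not> 3 dvd \<kappa> x - \<kappa> v" "\<not> 3 dvd \<kappa> x - \<kappa> (r x)"
    using proper(4,5) ends_f[OF assms(2)] ends_g[OF assms(2)] by blast+
  have ky: "\<not> 3 dvd \<kappa> y - \<kappa> (r y)"
    using proper(6) ends_g[OF assms(3)] by blast
  \<comment> \<open>The letters \<open>a\<close> to \<open>e\<close> stand for the colours of
    \<open>p\<close>, \<open>q\<close>, \<open>v\<close> and the two leaves, or of \<open>q\<close>,
    \<open>p\<close>, \<open>v\<close> and the two leaves in the mirrored case.\<close>
  have False if "\<not> 3 dvd a - b" "\<not> 3 dvd c - a" "\<not> 3 dvd c - b" "\<not> 3 dvd d - c" "\<not> 3 dvd d - a"
    "\<not> 3 dvd e - b" "3 dvd d - e" for a b c d e :: int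
    using that by presburger
  note contra = this
  have k': "\<not> 3 dvd \<kappa> q - \<kappa> p" using k(1) by presburger
  consider "r x = r y" | "r x = p" "r y = q" | "r x = q" "r y = p"
    using rim[OF assms(2)] rim[OF assms(3)] by auto
  then show ?thesis
  proof cases
    case 2
    then show ?thesis using contra[OF k kx(1), of "\<kappa> y"] kx(2) ky assms(4) by simp
  next
    case 3
    then show ?thesis using contra[OF k' k(3,2) kx(1), of "\<kappa> y"] kx(2) ky assms(4) by simp
  qed
qed

end

section \<open>Spanning two-trees in graphs without a flow\<close>

locale tree_in_flowless_graph =
  fan "ends G" V0 E0 v p q e0 ep eq L f g r
  for G :: "('v, 'e) mgraph" and V0 E0 v p q e0 ep eq L f g r +
  fixes \<kappa>
  assumes G: "multigraph G" and V: "vertices G = VL L" and sub: "EL L \<subseteq> edges G"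
    and no_flow: "\<not> orientable (ends G) (edges G) (\<lambda>_. 0)"
    and \<kappa>: "proper3 (ends G) (EL L) \<kappa>"
begin

abbreviation "extra \<equiv> edges G - EL L"

lemma on: "edges_on (ends G) (VL L) (edges G)"
  using multigraph_edges_on[OF G] V by simp

lemma finV: "finite (VL L)"
  using on by (simp add: edges_on_def)

text \<open>The tree realises every boundary of nonzero pairing with \<open>\<kappa>\<close>, so one
  extra edge split by \<open>\<kappa>\<close> would make the graph connected modulo 3.\<close>

lemma extra_unsplit:
  assumes "e \<in> extra" "ends G e = {a, b}"
  shows "3 dvd \<kappa> a - \<kappa> b"
proof (rule ccontr)
  assume "\<not> 3 dvd \<kappa> a - \<kappa> b"
  then have "splits (ends G) \<kappa> e" using assms(2) by (auto simp: splits_def)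
  then have "Z3_connected (ends G) (VL L) (edges G)"
    using Z3_connected_one_split[OF on sub two_tree_orientable[OF two_tree_sub[OF order_refl] \<kappa>] assms(1)]
    by blast
  then show False using no_flow Z3_connected_zero by blast
qed

lemma extra_ends:
  assumes e: "e \<in> extra"
  shows "\<exists>a b. a \<in> VL L \<and> b \<in> VL L \<and> a \<noteq> b \<and> ends G e = {a, b}"
  using assms on unfolding edges_on_def by blast

lemma extra_other_end:
  assumes "e \<in> extra" "x \<in> ends G e"
  shows "\<exists>c. ends G e = {x, c} \<and> c \<noteq> x"
  using extra_ends[OF assms(1)] assms(2) by (metis doubleton_eq_iff empty_iff insert_iff)

text \<open>The weight is the indicator of \<open>x\<close>: its pairing with \<open>\<beta>\<close>
  is \<open>\<beta> x\<close>, and it splits exactly the edges at \<open>x\<close>.\<close>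

lemma leaf_extra_edge:
  assumes "x \<in> L"
  shows "\<exists>!e. e \<in> extra \<and> x \<in> ends G e"
proof -
  have x: "x \<in> VL L" using assms by (auto simp: VL_def)
  have "\<exists>!e. e \<in> extra \<and> splits (ends G) (\<lambda>u. of_bool (u = x)) e"
    by (rule unique_split[OF on sub _ no_flow])
      (use leaf_orientable[OF assms] sum_of_bool_mult[OF finV x] in \<open>simp add: mult.commute\<close>)
  moreover have "splits (ends G) (\<lambda>u. of_bool (u = x)) e \<longleftrightarrow> x \<in> ends G e" if e: "e \<in> extra" for e
  proof -
    obtain a b where "ends G e = {a, b}" "a \<noteq> b" using extra_ends[OF e] by blast
    then show ?thesis by (auto simp: splits_iff[of "ends G" e a b])
  qed
  ultimately show ?thesis by blast
qed

text \<open>The weight whose pairing with \<open>\<beta>\<close> is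
  \<open>\<beta> v - sum \<beta> L\<close>, the quantity that controls
  \<open>fan_orientable\<close>.\<close>

definition \<phi> :: "'v \<Rightarrow> int" where
  "\<phi> u = of_bool (u = v) - of_bool (u \<in> L)"

lemma fan_extra_edge: "\<exists>!e. e \<in> extra \<and> splits (ends G) \<phi> e"
proof (rule unique_split[OF on sub _ no_flow])
  fix \<beta> assume \<beta>: "zero_sum (VL L) \<beta>" "3 dvd (\<Sum>u\<in>VL L. \<phi> u * \<beta> u)"
  have "(\<Sum>u\<in>VL L. of_bool (u \<in> L) * \<beta> u) = sum \<beta> L"
    by (rule sum.mono_neutral_cong_right[OF finV]) (auto simp: VL_def)
  moreover have "(\<Sum>u\<in>VL L. of_bool (u = v) * \<beta> u) = \<beta> v"
    by (rule sum_of_bool_mult[OF finV]) (simp add: VL_def)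
  ultimately have "(\<Sum>u\<in>VL L. \<phi> u * \<beta> u) = \<beta> v - sum \<beta> L"
    by (simp add: \<phi>_def left_diff_distrib sum_subtractf)
  then show "orientable (ends G) (EL L) \<beta>"
    using fan_orientable[OF order_refl \<beta>(1)] \<beta>(2) by simp
qed

lemma edges_at_leaf_G:
  assumes "x \<in> L" "e \<in> extra" "x \<in> ends G e"
  shows "{e \<in> edges G. x \<in> ends G e} = {f x, g x, e}" "degree G x = 3"
proof -
  have "{e \<in> edges G. x \<in> ends G e} = {e \<in> EL L. x \<in> ends G e} \<union> {e \<in> extra. x \<in> ends G e}"
    using sub by auto
  also have "{e \<in> extra. x \<in> ends G e} = {e}"
    using leaf_extra_edge[OF assms(1)] assms(2,3) by blast
  finally show *: "{e \<in> edges G. x \<in> ends G e} = {f x, g x, e}"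
    unfolding edges_at_leaf[OF assms(1)] by auto
  have "f x \<noteq> g x" "f x \<noteq> e" "g x \<noteq> e"
    using assms(1,2) leaf_fresh(4)[of x "L - {x}"] by (auto simp: EL_def)
  then show "degree G x = 3" unfolding degree_def * by simp
qed

lemma card_V0: "card V0 \<ge> 2"
  using two_tree_ge_2[OF base(1)] .

text \<open>Leaves joined by an extra edge have the same colour, hence the same rim. They form a
  bull with common neighbour \<open>v\<close> whose third neighbours coincide in \<open>r x\<close>,
  and removing two leaves keeps a triangle-tree.\<close>

lemma adjacent_leaves_reduction:
  assumes "x \<in> L" "y \<in> L" "x \<noteq> y" "e \<in> extra" "ends G e = {x, y}"
  shows "\<exists>G1. bull_reduction G G1 \<and> has_spanning_triangle_tree G1"
proof -
  have same: "r y = r x"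
    using unsplit_leaves_same_rim[OF \<kappa> assms(1,2)] extra_unsplit[OF assms(4,5)] by simp
  have neq: "r x \<noteq> x" "r x \<noteq> y" "r x \<noteq> v" "x \<noteq> v" "y \<noteq> v"
    using rim[OF assms(1)] pq leaves_new center(1) assms(1,2) by auto
  have ex: "{e \<in> edges G. x \<in> ends G e} = {e, f x, g x}" "degree G x = 3"
    and ey: "{e \<in> edges G. y \<in> ends G e} = {e, f y, g y}" "degree G y = 3"
    using edges_at_leaf_G[of x e] edges_at_leaf_G[of y e] assms by auto
  have nx: "neighbors G x = {y, v, r x}"
    by (rule neighbors_of_edges[OF ex(1)]) (use assms ends_f ends_g in auto)
  have ny: "neighbors G y = {x, v, r x}"
    by (rule neighbors_of_edges[OF ey(1)]) (use assms ends_f ends_g same in auto)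
  define H where "H = delete_vertices G {x, y}"
  define X where "X = L - {x, y}"
  have adj: "adjacent G x y" using assms(4,5) by (auto simp: adjacent_def)
  have xy: "x \<in> vertices G" "y \<in> vertices G" using assms(1,2) by (auto simp: V VL_def)
  have bull: "bull_reduction G H"
    by (rule bull_reductionI[OF G xy adj ex(2) ey(2) nx _ _ ny]) (use neq in \<open>simp_all add: H_def\<close>)
  have tt: "two_tree (ends G) (VL X) (EL X)" by (rule two_tree_sub) (auto simp: X_def)
  have VH: "vertices H = VL X"
    using leaves_new assms(1,2) by (auto simp: H_def X_def delete_vertices_def V VL_def)
  have "ends G d \<subseteq> VL X" if "d \<in> EL X" for d
    using two_tree_edges_on[OF tt] that by (auto elim!: edges_onE)
  then have "EL X \<subseteq> edges H"
    using sub VH by (auto simp: H_def delete_vertices_def EL_def X_def)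
  moreover have "card (VL X) \<ge> 3"
  proof -
    have fin: "finite (insert v V0)" using finite_VL[of "{}"] by (simp add: VL_def)
    then have "card (insert v V0) \<ge> 3" using card_V0 center(1) by simp
    also have "card (insert v V0) \<le> card (VL X)"
      by (rule card_mono) (use finite_VL[of X] in \<open>auto simp: VL_def X_def\<close>)
    finally show ?thesis .
  qed
  ultimately have "has_spanning_triangle_tree H"
    using tt VH by (intro has_spanning_triangle_treeI[of "ends G" H "EL X"])
      (auto simp: H_def delete_vertices_def)
  then show ?thesis using bull by blast
qed

text \<open>The edge \<open>e\<close> is split by \<open>\<phi>\<close>, so uniqueness keeps all
  extra edges away from \<open>v\<close>. Then \<open>x\<close> and \<open>v\<close> both have
  degree 3 and form a bull with common neighbour \<open>r x\<close>. Its removal leaves the base,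
  which is a triangle-tree unless it is a single edge, when the graph is complete on four
  vertices.\<close>

lemma single_leaf_reduction:
  assumes L: "L = {x}" and e: "e \<in> extra" "ends G e = {x, c}" and c: "c \<noteq> x"
  shows "is_K4 G \<or> (\<exists>G1. bull_reduction G G1 \<and> has_spanning_triangle_tree G1)"
proof -
  have x: "x \<in> L" using L by simp
  have cv: "c \<noteq> v" "c \<noteq> r x"
    using unsplit_leaf_edge[OF \<kappa> x extra_unsplit[OF e]] by auto
  have neq: "x \<noteq> v" "x \<notin> V0" using leaves_new L by auto
  obtain b where b: "{p, q} = {r x, b}" "b \<noteq> r x" "b \<in> V0" "r x \<in> V0"
    using rim[OF x] pq by (metis doubleton_eq_iff empty_iff insert_iff)
  obtain d where d: "d \<in> {ep, eq}" "ends G d = {v, r x}"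
    using center rim[OF x] by auto
  obtain d' where d': "d' \<in> {ep, eq}" "ends G d' = {v, b}"
    using center b by (metis doubleton_eq_iff insertCI)
  have dd: "d \<noteq> d'" using d(2) d'(2) b by (auto simp: doubleton_eq_iff)
  then have ddeq: "{d, d'} = {ep, eq}" using d(1) d'(1) by auto
  have split_e: "splits (ends G) \<phi> e"
    unfolding splits_iff[of "ends G" e x c, OF e(2)] \<phi>_def using neq cv c L by simp
  have no_v: "v \<notin> ends G d1" if d1: "d1 \<in> extra" for d1
  proof
    assume "v \<in> ends G d1"
    then obtain w where w: "ends G d1 = {v, w}" "w \<noteq> v"
      using extra_other_end[OF d1] by blast
    \<comment> \<open>The weight is 1 at \<open>v\<close> and 0 or -1 elsewhere, so any edge at
      \<open>v\<close> is split.\<close>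
    then have "splits (ends G) \<phi> d1"
      unfolding splits_iff[of "ends G" d1 v w, OF w(1)] \<phi>_def using neq w L by simp
    then have "d1 = e" using fan_extra_edge d1 e(1) split_e by blast
    then show False using \<open>v \<in> ends G d1\<close> e(2) cv neq by auto
  qed
  have at_v: "{e \<in> edges G. v \<in> ends G e} = {f x, d, d'}"
  proof -
    have "{e \<in> edges G. v \<in> ends G e} = {e \<in> EL L. v \<in> ends G e}"
      using sub no_v by auto
    also have "\<dots> = {f x} \<union> {d, d'}" unfolding edges_at_center[OF L] ddeq by auto
    finally show ?thesis by auto
  qed
  have "f x \<notin> {ep, eq}" using leaf_edges_new x by auto
  then have deg_v: "degree G v = 3"
    unfolding degree_def at_v using dd d(1) d'(1) by auto
  have at_x: "{e \<in> edges G. x \<in> ends G e} = {f x, g x, e}" "degree G x = 3"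
    using edges_at_leaf_G[OF x e(1)] e(2) by auto
  have nx: "neighbors G x = {v, r x, c}"
    by (rule neighbors_of_edges[OF at_x(1)]) (use e ends_f[OF x] ends_g[OF x] in auto)
  have nv: "neighbors G v = {x, r x, b}"
    by (rule neighbors_of_edges[OF at_v]) (use d d' ends_f[OF x] in auto)
  show ?thesis
  proof (cases "card V0 = 2")
    case True
    obtain p' q' e' where "V0 = {p', q'}" "E0 = {e'}" "ends G e' = {p', q'}"
      using two_tree_card_2[OF base(1) True] by blast
    then have E0: "E0 = {e0}" and V0: "V0 = {r x, b}"
      using base(2,3) b(1) by auto
    have VG: "vertices G = {x, v, r x, b}" unfolding V VL_def using L V0 by auto
    have "c \<in> vertices G" using G e by (auto simp: multigraph_def)
    then have cb: "c = b" using VG c cv by auto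
    \<comment> \<open>A second extra edge avoids both \<open>x\<close> and \<open>v\<close>, so it
      would be parallel to the base edge, whose ends differ in colour.\<close>
    have "d1 = e" if d1: "d1 \<in> extra" for d1
    proof (rule ccontr)
      assume "d1 \<noteq> e"
      then have "x \<notin> ends G d1" using leaf_extra_edge[OF x] d1 e by blast
      moreover obtain a a' where a: "a \<in> VL L" "a' \<in> VL L" "ends G d1 = {a, a'}" "a \<noteq> a'"
        using extra_ends[OF d1] by blast
      ultimately have "{a, a'} = {p, q}"
        using no_v[OF d1] VG V b(1) by auto
      then have "3 dvd \<kappa> p - \<kappa> q" using extra_unsplit[OF d1, of p q] a by simp
      moreover have "\<not> 3 dvd \<kappa> p - \<kappa> q"
        by (rule proper3D[OF \<kappa>, of e0]) (use base in \<open>auto simp: EL_def\<close>)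
      ultimately show False by simp
    qed
    then have "edges G = insert e (EL L)" using e(1) sub by blast
    also have "EL L = {f x, g x} \<union> ({ep, eq} \<union> {e0})"
      unfolding EL_def using L E0 by auto
    also have "insert e \<dots> = {f x, g x, e, d, d', e0}"
      unfolding ddeq[symmetric] by auto
    finally have EG: "edges G = {f x, g x, e, d, d', e0}" .
    have "is_K4 G"
      by (rule is_K4I[OF G VG _ EG])
        (use neq b cb e d d' ends_f[OF x] ends_g[OF x] base center V0 in auto)
    then show ?thesis ..
  next
    case False
    then have card: "card V0 \<ge> 3" using card_V0 by simp
    define D where "D = delete_vertices G {x, v}"
    \<comment> \<open>The new edge takes over the name \<open>f x\<close> of a deleted edge.\<close>
    define H where "H = (if c = b then D else add_edge D (f x) c b)"
    have fx: "f x \<notin> edges D" using ends_f[OF x] by (auto simp: D_def delete_vertices_def)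
    have adj: "adjacent G x v" using nx by (auto simp: neighbors_def)
    have xv: "x \<in> vertices G" "v \<in> vertices G" using x by (auto simp: V VL_def)
    have bull: "bull_reduction G H"
    proof (rule bull_reductionI[OF G xv adj at_x(2) deg_v nx cv nv])
      show "b \<noteq> x" "b \<noteq> r x" using b neq by auto
      show "if c = b then H = delete_vertices G {x, v}
        else \<exists>e. e \<notin> edges (delete_vertices G {x, v}) \<and> H = add_edge (delete_vertices G {x, v}) e c b"
        using fx by (auto simp: H_def D_def)
    qed
    have VH: "vertices H = V0"
      using neq center(1) by (auto simp: H_def D_def delete_vertices_def add_edge_def V VL_def L)
    have "ends G d \<subseteq> V0" if "d \<in> E0" for d
      using two_tree_edges_on[OF base(1)] that by (auto elim!: edges_onE)
    then have "E0 \<subseteq> edges D"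
      using sub neq center(1) by (auto simp: D_def delete_vertices_def EL_def)
    then have "has_spanning_triangle_tree H"
      using base(1) card VH fx
      by (intro has_spanning_triangle_treeI[of "ends G" H E0])
        (auto simp: H_def D_def delete_vertices_def add_edge_def)
    then show ?thesis using bull by blast
  qed
qed

text \<open>If no extra edge joins two leaves, the extra edge at each leaf is split by
  \<open>\<phi>\<close>. Uniqueness makes all these edges equal, and such an edge has only one end
  in \<open>L\<close>, so there is a single leaf.\<close>

lemma reduction:
  assumes "L \<noteq> {}"
  shows "is_K4 G \<or> (\<exists>G1. bull_reduction G G1 \<and> has_spanning_triangle_tree G1)"
proof (cases "\<exists>x\<in>L. \<exists>y\<in>L. \<exists>e\<in>extra. x \<noteq> y \<and> ends G e = {x, y}")
  case True
  then show ?thesis using adjacent_leaves_reduction by blast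
next
  case False
  have ex: "\<exists>e c. e \<in> extra \<and> ends G e = {x, c} \<and> c \<noteq> x \<and> c \<notin> L \<and> splits (ends G) \<phi> e"
    if x: "x \<in> L" for x
  proof -
    obtain e where e: "e \<in> extra" "x \<in> ends G e" using leaf_extra_edge[OF x] by blast
    then obtain c where c: "ends G e = {x, c}" "c \<noteq> x"
      using extra_other_end by blast
    then have "c \<notin> L" using False e(1) x by blast
    moreover have "x \<noteq> v" using leaves_new x by auto
    ultimately have "splits (ends G) \<phi> e"
      using x by (simp add: splits_iff[of "ends G" e x c, OF c(1)] \<phi>_def)
    then show ?thesis using e(1) c \<open>c \<notin> L\<close> by blast
  qed
  obtain x where x: "x \<in> L" using assms by blast
  then obtain e c where e: "e \<in> extra" "ends G e = {x, c}" "c \<noteq> x" "c \<notin> L" "splits (ends G) \<phi> e"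
    using ex by blast
  have "y = x" if y: "y \<in> L" for y
  proof -
    obtain e' c' where e': "e' \<in> extra" "ends G e' = {y, c'}" "splits (ends G) \<phi> e'"
      using ex[OF y] by blast
    then have "e' = e" using fan_extra_edge e by blast
    then show ?thesis using e e' y by (auto simp: doubleton_eq_iff)
  qed
  then have "L = {x}" using x by blast
  then show ?thesis by (rule single_leaf_reduction) (use e in auto)
qed

end

section \<open>Reduction of flowless graphs down to the complete graph on four vertices\<close>

lemma flowless_reduction:
  assumes "multigraph G" "has_spanning_triangle_tree G" "\<not> has_nowhere_zero_3_flow G"
  shows "is_K4 G \<or> (\<exists>G1. bull_reduction G G1 \<and> has_spanning_triangle_tree G1)"
proof -
  obtain E where tt: "two_tree (ends G) (vertices G) E" and sub: "E \<subseteq> edges G"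
    and card: "card (vertices G) \<ge> 3"
    using assms(2) by (rule has_spanning_triangle_treeE)
  have no: "\<not> orientable (ends G) (edges G) (\<lambda>_. 0)"
    using assms(3) has_nowhere_zero_3_flow_iff[OF assms(1)] by simp
  obtain \<kappa> where \<kappa>: "proper3 (ends G) E \<kappa>" using two_tree_proper3[OF tt] ..
  note on = multigraph_edges_on[OF assms(1)]
  \<comment> \<open>On three vertices an extra edge would be parallel to a triangle edge and hence
    split by \<open>\<kappa>\<close>, while the bare triangle has a balanced orientation.\<close>
  have "card (vertices G) \<noteq> 3"
  proof
    assume "card (vertices G) = 3"
    obtain e y z where e: "e \<in> E" "ends G e = {y, z}"
      using two_tree_has_edge[OF tt] by blast
    obtain q e' e'' where t: "is_triangle (ends G) (vertices G) E y z q e e' e''"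
      using two_tree_card_3[OF tt \<open>card (vertices G) = 3\<close> e] by blast
    have "Z3_connected (ends G) (vertices G) (edges G)" if "e1 \<in> edges G - E" for e1
    proof -
      obtain a b where ab: "a \<in> vertices G" "b \<in> vertices G" "ends G e1 = {a, b}" "a \<noteq> b"
        using on \<open>e1 \<in> edges G - E\<close> unfolding edges_on_def by blast
      have V3: "vertices G = {y, z, q}" and img: "ends G ` E = {{y, z}, {y, q}, {z, q}}"
        using t by (auto simp: is_triangle_def)
      have "{a, b} \<in> ends G ` E"
        using ab(1,2,4) unfolding img V3
        by (elim insertE emptyE; hypsubst?; simp add: insert_commute)
      then obtain e2 where "e2 \<in> E" "ends G e2 = {a, b}" by force
      then have "splits (ends G) \<kappa> e1"
        using proper3D[OF \<kappa>] ab(3) unfolding splits_def by blast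
      then show ?thesis
        using Z3_connected_one_split[OF on sub two_tree_orientable[OF tt \<kappa>] that] by blast
    qed
    then have "edges G = E" using no sub Z3_connected_zero by blast
    moreover have "orientable (ends G) (insert e (insert e' {e''})) (\<lambda>_. 0)"
      by (rule two_tree_attach_orientable_zero[of _ "{z, q}" _ e'' z q y])
        (use t in \<open>auto simp: is_triangle_def zero_sum_def intro!: two_tree.edge\<close>)
    ultimately show False using no t by (simp add: is_triangle_def)
  qed
  then have "has_fan (ends G) (vertices G) E"
    using two_tree_has_fan[OF tt] card by simp
  then obtain V0 E0 v p q e0 ep eq L f g r where
    fan: "fan (ends G) V0 E0 v p q e0 ep eq L f g r" and L: "L \<noteq> {}"
      "vertices G = fan.VL V0 v L" "E = fan.EL E0 ep eq f g L"
    unfolding has_fan_def by blast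
  interpret fan "ends G" V0 E0 v p q e0 ep eq L f g r by (rule fan)
  interpret tree_in_flowless_graph G V0 E0 v p q e0 ep eq L f g r \<kappa>
    by (intro tree_in_flowless_graph.intro tree_in_flowless_graph_axioms.intro fan)
      (use assms(1) L sub no \<kappa> in simp_all)
  show ?thesis by (rule reduction[OF L(1)])
qed

text \<open>A bull-reduction has fewer vertices and preserves the absence of a flow, so the
  reduction can be iterated.\<close>

lemma flowless_formed_from_K4:
  assumes "multigraph G" "has_spanning_triangle_tree G" "\<not> has_nowhere_zero_3_flow G"
  shows "formed_from_K4 G"
  using assms
proof (induction "card (vertices G)" arbitrary: G rule: less_induct)
  case less
  from flowless_reduction[OF less.prems] show ?case
  proof
    assume "\<exists>G1. bull_reduction G G1 \<and> has_spanning_triangle_tree G1"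
    then obtain G1 where G1: "bull_reduction G G1" "has_spanning_triangle_tree G1" by blast
    then have "formed_from_K4 G1"
      using less bull_reduction_props[OF G1(1)] by blast
    then show ?thesis using G1(1) by (rule formed_from_K4.grow)
  qed (rule formed_from_K4.K4)
qed

theorem theorem1p6:
  fixes G :: "('v, 'e) mgraph"
  assumes "multigraph G" and "has_spanning_triangle_tree G"
  shows "(\<not> has_nowhere_zero_3_flow G \<longleftrightarrow>
            is_K4 G \<or>
            (\<exists>G1 :: ('v, 'e) mgraph. multigraph G1 \<and> bull_growing G G1 \<and>
               has_spanning_triangle_tree G1 \<and> \<not> has_nowhere_zero_3_flow G1)) \<and>
         (\<not> has_nowhere_zero_3_flow G \<longleftrightarrow> formed_from_K4 G)"
  using flowless_reduction[OF assms] flowless_formed_from_K4[OF assms] formed_from_K4_no_flow[of G]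
    is_K4_no_flow[of G] bull_reduction_props[of G]
  by blast

end
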